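(* For all $\zeta>0$ there exist positive constants $k,C_1,C_2,N$ such that for all measures $\mu$ on $\mathbb{R}$ (with associated exponential family $\{P_\theta\}_{\theta\in\Phi}$), all $\theta\in\Phi$ and all $n\in\mathbb{N}$ with $n\ge N$: if - $\varepsilon_n\ge\frac{k}{\sqrt n}$, - $\displaystyle\max_{\theta'\in\Phi(\theta)}\frac{\mathbb{E}_{\theta'}\big((x-A'(\theta'))^4\big)}{A''(\theta')^2}\le\zeta$, where $\Phi(\theta)=[\theta-\kappa(\theta),\theta+\kappa(\theta)]$, - $\kappa(\theta)\ge\frac{C_2}{\sqrt{nA''(\theta)}}$, then $$\frac{C_1}{\sqrt{nA''(\theta)}}\le\omega_n(P_\theta,\mathcal{F}^{\rm test}_{\varepsilon_n})\le\frac{C_2}{\sqrt{nA''(\theta)}}.$$ Consequently $\omega_n(P_\theta,\mathcal{F}^{\rm test}_{\varepsilon_n})=\Theta\big(\omega_n(P_\theta,\mathcal{F}^{\rm test})\big)$, where $\mathcal{F}^{\rm test}$ is the class of all (not necessarily private) tests.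
   Context: Exponential family: for a measure $\mu$ on $\mathbb{R}$, $A(\theta)=\ln\int e^{\theta x}d\mu(x)$, $\Phi=\{\theta: A(\theta)<\infty\}$, and for $\theta\in\Phi$, $P_\theta$ is the distribution with density $p_\theta(x)=e^{\theta x-A(\theta)}$ relative to $\mu$. Then $\mathbb{E}_\theta[x]=A'(\theta)$ and $\mathrm{var}_\theta(x)=A''(\theta)$. It is implicitly assumed that $\mu$ is not concentrated at one point (so $A''>0$) and that parameters considered are interior points of $\Phi$. $\kappa(\theta)=\sup\{r : \forall\theta'\in[\theta-r,\theta+r],\ A''(\theta)/A''(\theta')\in[\tfrac12,2]\}$ (the interval being required to lie where $A''$ is defined; $\kappa(\theta)$ may be $+\infty$). A randomized mechanism $M$ is $\varepsilon$-differentially private if for all datasets $d,d'$ of size $n$ differing in a single record and all events $E$, $\Pr[M(d)\in E]\le e^\varepsilon\Pr[M(d')\in E]$. $\mathcal{F}^{\rm test}_\varepsilon$ is the class of all $\varepsilon$-differentially private tests (randomized $\{0,1\}$-valued functions of the sample). $\varepsilon_n>0$ is the privacy parameter at sample size $n$. A test $T$ distinguishes $P,Q$ with $n$ samples if $\Pr(T(P^n)=0)\ge0.75$ and $\Pr(T(Q^n)=1)\ge0.75$. For a class of tests $\mathcal{G}$, $\mathrm{SC}_{\mathcal{G}}(P,Q)$ is the smallest $n$ such that some $T\in\mathcal{G}$ distinguishes $P$ and $Q$ with $N$ samples for all $N\ge n$. The modulus of continuity is $$\omega_n(P_\theta,\mathcal{G})=\sup\{|\theta-\theta'| : \theta'\in\Phi,\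 \mathrm{SC}_{\mathcal{G}}(P_\theta,P_{\theta'})>n\}.$$ *)

theory Defs
  imports "HOL-Probability.Probability"
begin

section \<open>One-parameter exponential families\<close>

definition natural_params :: "real measure \<Rightarrow> real set" where
  "natural_params \<mu> = {\<theta>. (\<integral>\<^sup>+x. ennreal (exp (\<theta> * x)) \<partial>\<mu>) < \<infinity>}"

text \<open>The value \<open>log_partition \<mu> \<theta>\<close> is meaningful only for \<open>\<theta> \<in> natural_params \<mu>\<close>;
  the informal \<open>A(\<theta>) = \<infinity>\<close> is expressed by non-membership.\<close>

definition log_partition :: "real measure \<Rightarrow> real \<Rightarrow> real" where
  "log_partition \<mu> \<theta> = ln (\<integral>x. exp (\<theta> * x) \<partial>\<mu>)"

definition exp_family :: "real measure \<Rightarrow> real \<Rightarrow> real measure" where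
  "exp_family \<mu> \<theta> = density \<mu> (\<lambda>x. ennreal (exp (\<theta> * x - log_partition \<mu> \<theta>)))"

abbreviation A' :: "real measure \<Rightarrow> real \<Rightarrow> real" where
  "A' \<mu> \<equiv> deriv (log_partition \<mu>)"

abbreviation A'' :: "real measure \<Rightarrow> real \<Rightarrow> real" where
  "A'' \<mu> \<equiv> deriv (A' \<mu>)"

text \<open>\<open>A''\<close> is a two-sided derivative, defined on the interior of the natural parameter set;
  the radius may be infinite.\<close>

definition kappa :: "real measure \<Rightarrow> real \<Rightarrow> ereal" where
  "kappa \<mu> \<theta> = Sup {ereal r | r. 0 \<le> r \<and>
     (\<forall>\<theta>'\<in>{\<theta> - r..\<theta> + r}. \<theta>' \<in> interior (natural_params \<mu>) \<and>
        A'' \<mu> \<theta> / A'' \<mu> \<theta>' \<in> {1/2..2})}"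

text \<open>The interval \<open>[\<theta> - \<kappa>(\<theta>), \<theta> + \<kappa>(\<theta>)]\<close>; all of \<open>\<real>\<close> if the radius is infinite. When the radius
  is finite, an end point can be a boundary point of the natural parameter set, where \<open>A'\<close> and
  \<open>A''\<close> are not (two-sided) derivatives; such end points are left out.\<close>

definition kappa_interval :: "real measure \<Rightarrow> real \<Rightarrow> real set" where
  "kappa_interval \<mu> \<theta> =
     {\<theta>'. ereal \<bar>\<theta>' - \<theta>\<bar> \<le> kappa \<mu> \<theta>} \<inter> interior (natural_params \<mu>)"

section \<open>Randomized tests and differential privacy\<close>

text \<open>A dataset of size \<open>n\<close> is an (extensional) function on \<open>{..<n}\<close>.\<close>

abbreviation datasets :: "nat \<Rightarrow> (nat \<Rightarrow> real) measure" where
  "datasets n \<equiv> PiM {..<n} (\<lambda>_. borel)"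

text \<open>A mechanism on datasets of size \<open>n\<close> maps a dataset to its output distribution on \<open>R\<close>.\<close>

definition differentially_private ::
    "real \<Rightarrow> nat \<Rightarrow> 'b measure \<Rightarrow> ((nat \<Rightarrow> real) \<Rightarrow> 'b measure) \<Rightarrow> bool" where
  "differentially_private \<epsilon> n R M \<longleftrightarrow>
     (\<forall>d\<in>space (datasets n). \<forall>d'\<in>space (datasets n).
        (\<exists>i<n. \<forall>j<n. j \<noteq> i \<longrightarrow> d j = d' j) \<longrightarrow>
        (\<forall>E\<in>sets R. measure (M d) E \<le> exp \<epsilon> * measure (M d') E))"

text \<open>A randomized test takes samples of every size; the outcomes \<open>0\<close> and \<open>1\<close> are rendered as
  \<^const>\<open>False\<close> and \<^const>\<open>True\<close>.\<close>

type_synonym test = "nat \<Rightarrow> (nat \<Rightarrow> real) \<Rightarrow> bool measure"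

definition tests :: "test set" where
  "tests = {T. \<forall>n. T n \<in> datasets n \<rightarrow>\<^sub>M prob_algebra (count_space UNIV)}"

definition private_tests :: "real \<Rightarrow> test set" where
  "private_tests \<epsilon> = {T \<in> tests. \<forall>n. differentially_private \<epsilon> n (count_space UNIV) (T n)}"

text \<open>The probability that \<open>T\<close> outputs \<open>b\<close> on \<open>n\<close> independent samples from \<open>P\<close>.\<close>

definition output_prob :: "test \<Rightarrow> nat \<Rightarrow> real measure \<Rightarrow> bool \<Rightarrow> real" where
  "output_prob T n P b = measure (PiM {..<n} (\<lambda>_. P) \<bind> T n) {b}"

definition distinguishes :: "test \<Rightarrow> nat \<Rightarrow> real measure \<Rightarrow> real measure \<Rightarrow> bool" where
  "distinguishes T n P Q \<longleftrightarrow>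
     output_prob T n P False \<ge> 3/4 \<and> output_prob T n Q True \<ge> 3/4"

text \<open>The infimum over the empty set is \<open>\<infinity>\<close>.\<close>

definition sample_complexity :: "test set \<Rightarrow> real measure \<Rightarrow> real measure \<Rightarrow> enat" where
  "sample_complexity G P Q =
     Inf {enat n | n. \<exists>T\<in>G. \<forall>m\<ge>n. distinguishes T m P Q}"

definition modulus :: "real measure \<Rightarrow> nat \<Rightarrow> real \<Rightarrow> test set \<Rightarrow> ereal" where
  "modulus \<mu> n \<theta> G =
     Sup {ereal \<bar>\<theta> - \<theta>'\<bar> | \<theta>'. \<theta>' \<in> natural_params \<mu> \<and>
       sample_complexity G (exp_family \<mu> \<theta>) (exp_family \<mu> \<theta>') > enat n}"

end

theory Submission
  imports Defs
begin

text \<open>Lower bound: for \<open>\<theta>' = \<theta> + h\<close> the second moment of the likelihood ratio under \<open>P\<^sub>\<theta>\<close> is the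
  exponential of \<open>A(\<theta> + 2h) - 2 A(\<theta> + h) + A(\<theta>) \<le> 2 A''(\<theta>) h\<^sup>2\<close>. If \<open>n A''(\<theta>) h\<^sup>2 = 1/4\<close>, the
  second moment of the \<open>n\<close>-fold likelihood ratio is below \<open>2\<close>, and no test, private or not,
  distinguishes the two distributions with \<open>n\<close> samples.

  Upper bound: clamp the standardised observation to \<open>[-B, B]\<close> with \<open>B\<close> of order \<open>sqrt \<zeta>\<close>, and
  accept with probability a sigmoid of the centred sum, scaled by \<open>1 / sqrt n\<close>. The mean of the
  unclamped score moves by at least \<open>h sqrt (A''(\<theta>)) / 2\<close> as the parameter moves by \<open>h\<close>; by
  Cauchy--Schwarz, the fourth moment and the chi-squared bound above, clamping costs at most half of
  that. As the clamped score is monotone and the family has monotone likelihood ratio, the shift at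
  a nearby parameter bounds the shift at every parameter further away. The errors are estimated by
  a Chernoff bound, which tensorises.\<close>

section \<open>Regularity of the log-partition function\<close>

text \<open>A crude Taylor remainder, used to differentiate under the integral. Multiplying
  \<open>1 - y \<le> exp (- y)\<close> by \<open>exp y\<close> bounds the remainder by
  \<open>y * (exp y - 1)\<close>, and the first-order increment is at most
  \<open>\<bar>y\<bar> * exp \<bar>y\<bar>\<close>.\<close>

lemma exp_remainder_bound:
  fixes y :: real
  shows "\<bar>exp y - 1 - y\<bar> \<le> y\<^sup>2 * exp \<bar>y\<bar>"
proof -
  have e: "1 - y \<le> exp (- y)" "1 + y \<le> exp y"
    using exp_ge_add_one_self[of "-y"] exp_ge_add_one_self[of y] by auto
  have "exp y * (1 - y) \<le> exp y * exp (- y)"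
    using e by (intro mult_left_mono) auto
  then have *: "exp y - 1 - y \<le> y * (exp y - 1)"
    by (simp add: algebra_simps flip: exp_add)
  have **: "\<bar>exp y - 1\<bar> \<le> \<bar>y\<bar> * exp \<bar>y\<bar>"
  proof (cases "y \<ge> 0")
    case True
    then show ?thesis using \<open>exp y * (1 - y) \<le> exp y * exp (- y)\<close>
      by (simp add: algebra_simps flip: exp_add)
  next
    case False
    then have "1 - exp y \<le> - y" using e by linarith
    also have "\<dots> \<le> - y * exp (- y)" using False by simp
    finally show ?thesis using False by (simp add: abs_if)
  qed
  have "y * (exp y - 1) \<le> \<bar>y\<bar> * \<bar>exp y - 1\<bar>"
    by (metis abs_ge_self abs_mult)
  also have "\<dots> \<le> \<bar>y\<bar> * (\<bar>y\<bar> * exp \<bar>y\<bar>)"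
    using ** by (intro mult_left_mono) auto
  also have "\<dots> = y\<^sup>2 * exp \<bar>y\<bar>" by (simp add: power2_eq_square)
  finally show ?thesis using * e by linarith
qed

text \<open>Apply \<open>u \<le> exp u\<close> to \<open>u = d * \<bar>x\<bar> / k\<close> and take
  the k-th power.\<close>

lemma abs_power_le_exp:
  fixes x d :: real
  assumes "d > 0"
  shows "\<bar>x\<bar> ^ k \<le> (real k / d) ^ k * exp (d * \<bar>x\<bar>)"
proof (cases "k = 0")
  case False
  have "d * \<bar>x\<bar> / k \<le> exp (d * \<bar>x\<bar> / k)"
    using exp_ge_add_one_self[of "d * \<bar>x\<bar> / k"] by linarith
  then have "\<bar>x\<bar> \<le> real k / d * exp (d * \<bar>x\<bar> / k)"
    using False assms by (simp add: field_simps)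
  then have "\<bar>x\<bar> ^ k \<le> (real k / d * exp (d * \<bar>x\<bar> / k)) ^ k"
    by (intro power_mono) auto
  also have "\<dots> = (real k / d) ^ k * exp (d * \<bar>x\<bar>)"
    unfolding power_mult_distrib using False by (simp flip: exp_of_nat_mult)
  finally show ?thesis .
qed (use assms in simp)

section \<open>The Laplace transform of the base measure and its derivatives\<close>

locale nondegenerate_measure =
  fixes \<mu> :: "real measure"
  assumes sets_mu [measurable_cong]: "sets \<mu> = sets borel"
    and nondegenerate: "\<not> (\<exists>x. AE y in \<mu>. y = x)"
begin

lemma borel_measurable_mu [simp]: "borel_measurable \<mu> = borel_measurable borel"
  using sets_mu by (rule measurable_cong_sets) simp

lemma natural_params_iff: "t \<in> natural_params \<mu> \<longleftrightarrow> integrable \<mu> (\<lambda>x. exp (t * x))"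
  by (auto simp: natural_params_def integrable_iff_bounded)

text \<open>An interior parameter leaves slack \<open>2 * d\<close> on both sides. One
  \<open>d\<close> absorbs the power of \<open>x\<close>; the other remains as the weight
  \<open>exp (d * \<bar>x\<bar>)\<close>, which dominates the integrands at all parameters within
  \<open>d\<close>.\<close>

lemma integrable_power_exp:
  assumes "\<theta> \<in> interior (natural_params \<mu>)"
  obtains d where "d > 0" "\<And>k. integrable \<mu> (\<lambda>x. \<bar>x\<bar> ^ k * exp (\<theta> * x + d * \<bar>x\<bar>))"
proof -
  obtain e where e: "e > 0" "cball \<theta> e \<subseteq> natural_params \<mu>"
    using assms mem_interior_cball by blast
  define d where "d = e / 2"
  have d: "d > 0" "\<theta> + 2 * d \<in> natural_params \<mu>" "\<theta> - 2 * d \<in> natural_params \<mu>"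
    using e unfolding d_def by (auto intro!: subsetD[OF e(2)] simp: dist_real_def)
  have "integrable \<mu> (\<lambda>x. \<bar>x\<bar> ^ k * exp (\<theta> * x + d * \<bar>x\<bar>))" for k
  proof (rule Bochner_Integration.integrable_bound)
    show "integrable \<mu> (\<lambda>x. (real k / d) ^ k * (exp ((\<theta> + 2 * d) * x) + exp ((\<theta> - 2 * d) * x)))"
      using d unfolding natural_params_iff by auto
    show "AE x in \<mu>. norm (\<bar>x\<bar> ^ k * exp (\<theta> * x + d * \<bar>x\<bar>))
        \<le> norm ((real k / d) ^ k * (exp ((\<theta> + 2 * d) * x) + exp ((\<theta> - 2 * d) * x)))"
    proof (rule AE_I2)
      fix x
      have "\<bar>x\<bar> ^ k * exp (\<theta> * x + d * \<bar>x\<bar>)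
          \<le> (real k / d) ^ k * exp (d * \<bar>x\<bar>) * exp (\<theta> * x + d * \<bar>x\<bar>)"
        using abs_power_le_exp[OF d(1)] by (intro mult_right_mono) auto
      also have "\<dots> = (real k / d) ^ k * exp (\<theta> * x + 2 * d * \<bar>x\<bar>)"
        by (simp add: algebra_simps flip: exp_add)
      also have "\<dots> \<le> (real k / d) ^ k * (exp ((\<theta> + 2 * d) * x) + exp ((\<theta> - 2 * d) * x))"
        using d by (intro mult_left_mono) (auto simp: abs_if algebra_simps add_increasing)
      finally show "norm (\<bar>x\<bar> ^ k * exp (\<theta> * x + d * \<bar>x\<bar>))
        \<le> norm ((real k / d) ^ k * (exp ((\<theta> + 2 * d) * x) + exp ((\<theta> - 2 * d) * x)))"
        using d(1) by (simp add: abs_mult)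
    qed
  qed simp
  with d that show ?thesis by blast
qed

text \<open>Unnormalised: \<open>moment 0\<close> is the Laplace transform, and
  \<open>moment k\<close> turns out to be its k-th derivative on the interior.\<close>

definition moment :: "nat \<Rightarrow> real \<Rightarrow> real" where
  "moment k t = (\<integral>x. x ^ k * exp (t * x) \<partial>\<mu>)"

lemma integrable_moment:
  assumes "\<theta> \<in> interior (natural_params \<mu>)"
  shows "integrable \<mu> (\<lambda>x. x ^ k * exp (\<theta> * x))"
proof -
  obtain d where d: "d > 0" "\<And>k. integrable \<mu> (\<lambda>x. \<bar>x\<bar> ^ k * exp (\<theta> * x + d * \<bar>x\<bar>))"
    using integrable_power_exp[OF assms] by blast
  show ?thesis
    by (rule Bochner_Integration.integrable_bound[OF d(2)[of k]])
       (use d in \<open>auto simp: abs_mult power_abs intro!: mult_left_mono\<close>)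
qed

text \<open>Differentiation under the integral with an explicit rate: the second-order remainder of
  \<open>exp (h * x)\<close> is dominated by \<open>h\<^sup>2\<close> times a fixed integrable
  function, so the difference quotient is off by at most \<open>C * \<bar>h\<bar>\<close>.\<close>

lemma moment_has_derivative:
  assumes \<theta>: "\<theta> \<in> interior (natural_params \<mu>)"
  shows "(moment k has_real_derivative moment (Suc k) \<theta>) (at \<theta>)"
proof -
  obtain d where d: "d > 0" "\<And>k. integrable \<mu> (\<lambda>x. \<bar>x\<bar> ^ k * exp (\<theta> * x + d * \<bar>x\<bar>))"
    using integrable_power_exp[OF assms] by blast
  define C where "C = (\<integral>x. \<bar>x\<bar> ^ (k + 2) * exp (\<theta> * x + d * \<bar>x\<bar>) \<partial>\<mu>)"
  have ev: "\<forall>\<^sub>F h in at 0. \<bar>h\<bar> < d \<and> \<theta> + h \<in> interior (natural_params \<mu>)"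
  proof (intro eventually_conj)
    show "\<forall>\<^sub>F h in at (0::real). \<bar>h\<bar> < d"
      using d(1) by (auto simp: eventually_at dist_real_def)
    have "((\<lambda>h. \<theta> + h) \<longlongrightarrow> \<theta> + 0) (at 0)" by (intro tendsto_intros)
    then show "\<forall>\<^sub>F h in at (0::real). \<theta> + h \<in> interior (natural_params \<mu>)"
      using \<theta> by (intro topological_tendstoD[where l = \<theta>]) auto
  qed
  have bound: "\<bar>(moment k (\<theta> + h) - moment k \<theta>) / h - moment (Suc k) \<theta>\<bar> \<le> C * \<bar>h\<bar>"
    if h: "\<bar>h\<bar> < d" "\<theta> + h \<in> interior (natural_params \<mu>)" "h \<noteq> 0" for h
  proof -
    let ?r = "\<lambda>x. x ^ k * exp ((\<theta> + h) * x) - x ^ k * exp (\<theta> * x) - h * (x ^ Suc k * exp (\<theta> * x))"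
    note int = integrable_moment[OF \<theta>] integrable_moment[OF h(2)]
    have "\<bar>moment k (\<theta> + h) - moment k \<theta> - h * moment (Suc k) \<theta>\<bar> = \<bar>\<integral>x. ?r x \<partial>\<mu>\<bar>"
      unfolding moment_def
      using int by (simp del: power_Suc)
    also have "\<dots> \<le> (\<integral>x. h\<^sup>2 * (\<bar>x\<bar> ^ (k + 2) * exp (\<theta> * x + d * \<bar>x\<bar>)) \<partial>\<mu>)"
    proof (rule order_trans[OF integral_abs_bound], rule integral_mono)
      show "integrable \<mu> (\<lambda>x. \<bar>?r x\<bar>)"
        using int by (intro integrable_abs Bochner_Integration.integrable_diff integrable_mult_right)
      show "integrable \<mu> (\<lambda>x. h\<^sup>2 * (\<bar>x\<bar> ^ (k + 2) * exp (\<theta> * x + d * \<bar>x\<bar>)))"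
        using d by (intro integrable_mult_right)
      fix x
      have "?r x = x ^ k * exp (\<theta> * x) * (exp (h * x) - 1 - h * x)"
        by (simp add: algebra_simps flip: exp_add)
      then have "\<bar>?r x\<bar> = \<bar>x\<bar> ^ k * exp (\<theta> * x) * \<bar>exp (h * x) - 1 - h * x\<bar>"
        by (simp add: abs_mult power_abs)
      also have "\<dots> \<le> \<bar>x\<bar> ^ k * exp (\<theta> * x) * ((h * x)\<^sup>2 * exp (d * \<bar>x\<bar>))"
      proof (intro mult_left_mono order_trans[OF exp_remainder_bound])
        show "exp \<bar>h * x\<bar> \<le> exp (d * \<bar>x\<bar>)"
          using h by (auto simp: abs_mult intro!: mult_right_mono)
      qed auto
      also have "\<dots> = h\<^sup>2 * (\<bar>x\<bar> ^ (k + 2) * exp (\<theta> * x + d * \<bar>x\<bar>))"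
        by (simp only: power_mult_distrib exp_add power_add power2_abs mult_ac)
      finally show "\<bar>?r x\<bar> \<le> h\<^sup>2 * (\<bar>x\<bar> ^ (k + 2) * exp (\<theta> * x + d * \<bar>x\<bar>))" .
    qed
    also have "\<dots> = h\<^sup>2 * C" by (simp add: C_def)
    finally have *: "\<bar>moment k (\<theta> + h) - moment k \<theta> - h * moment (Suc k) \<theta>\<bar> \<le> h\<^sup>2 * C" .
    have "(moment k (\<theta> + h) - moment k \<theta>) / h - moment (Suc k) \<theta>
        = (moment k (\<theta> + h) - moment k \<theta> - h * moment (Suc k) \<theta>) / h"
      using h(3) by (simp add: field_simps)
    then have "\<bar>(moment k (\<theta> + h) - moment k \<theta>) / h - moment (Suc k) \<theta>\<bar>
        = \<bar>moment k (\<theta> + h) - moment k \<theta> - h * moment (Suc k) \<theta>\<bar> / \<bar>h\<bar>"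
      by (simp only: abs_divide)
    also have "\<dots> \<le> h\<^sup>2 * C / \<bar>h\<bar>" using * by (intro divide_right_mono) auto
    also have "\<dots> = C * \<bar>h\<bar>" using h(3) by (simp add: field_simps power2_eq_square)
    finally show ?thesis .
  qed
  have "((\<lambda>h. (moment k (\<theta> + h) - moment k \<theta>) / h - moment (Suc k) \<theta>) \<longlongrightarrow> 0) (at 0)"
  proof (rule Lim_null_comparison)
    show "((\<lambda>h. C * \<bar>h\<bar>) \<longlongrightarrow> 0) (at 0)"
      by (auto intro!: tendsto_eq_intros)
    show "\<forall>\<^sub>F h in at 0. norm ((moment k (\<theta> + h) - moment k \<theta>) / h - moment (Suc k) \<theta>) \<le> C * \<bar>h\<bar>"
      using ev bound by (auto simp: eventually_at_filter elim!: eventually_mono)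
  qed
  then show ?thesis
    unfolding has_field_derivative_def[symmetric] DERIV_def by (simp add: LIM_zero_iff)
qed

lemma integral_exp_pos:
  assumes "\<theta> \<in> natural_params \<mu>"
  shows "(\<integral>x. exp (\<theta> * x) \<partial>\<mu>) > 0"
proof -
  have "(\<integral>x. exp (\<theta> * x) \<partial>\<mu>) \<noteq> 0"
  proof
    assume "(\<integral>x. exp (\<theta> * x) \<partial>\<mu>) = 0"
    then have "AE x in \<mu>. exp (\<theta> * x) = 0"
      using assms unfolding natural_params_iff by (subst (asm) integral_nonneg_eq_0_iff_AE) auto
    \<comment> \<open>As \<open>exp\<close> never vanishes, the whole space would be null; then
      every almost-everywhere statement holds, and nondegeneracy excludes this.\<close>
    then have "AE x in \<mu>. x = 0" by (rule eventually_mono) simp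
    then show False using nondegenerate by blast
  qed
  moreover have "(\<integral>x. exp (\<theta> * x) \<partial>\<mu>) \<ge> 0" by simp
  ultimately show ?thesis by linarith
qed

lemma moment_0_pos: "\<theta> \<in> interior (natural_params \<mu>) \<Longrightarrow> moment 0 \<theta> > 0"
  using integral_exp_pos[of \<theta>] interior_subset[of "natural_params \<mu>"] by (auto simp: moment_def)

lemma log_partition_eq: "log_partition \<mu> = (\<lambda>t. ln (moment 0 t))"
  by (auto simp: log_partition_def moment_def)

lemma log_partition_has_derivative:
  assumes "\<theta> \<in> interior (natural_params \<mu>)"
  shows "(log_partition \<mu> has_real_derivative moment 1 \<theta> / moment 0 \<theta>) (at \<theta>)"
  unfolding log_partition_eq
  using moment_has_derivative[OF assms, of 0] moment_0_pos[OF assms]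
  by (auto intro!: derivative_eq_intros)

lemma A'_eq: "\<theta> \<in> interior (natural_params \<mu>) \<Longrightarrow> A' \<mu> \<theta> = moment 1 \<theta> / moment 0 \<theta>"
  by (intro DERIV_imp_deriv log_partition_has_derivative)

lemma A'_has_derivative_moment:
  assumes "\<theta> \<in> interior (natural_params \<mu>)"
  shows "(A' \<mu> has_real_derivative moment 2 \<theta> / moment 0 \<theta> - (moment 1 \<theta> / moment 0 \<theta>)\<^sup>2) (at \<theta>)"
proof (rule DERIV_cong_ev[THEN iffD1])
  show "((\<lambda>t. moment 1 t / moment 0 t) has_real_derivative
      moment 2 \<theta> / moment 0 \<theta> - (moment 1 \<theta> / moment 0 \<theta>)\<^sup>2) (at \<theta>)"
    using moment_has_derivative[OF assms, of 0] moment_has_derivative[OF assms, of 1]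
      moment_0_pos[OF assms]
    by (auto intro!: derivative_eq_intros simp: field_simps power2_eq_square numeral_2_eq_2)
  \<comment> \<open>\<open>A'\<close> is known to be the moment quotient only on the interior;
    openness gives agreement on a neighbourhood, which suffices to transfer the derivative.\<close>
  show "\<forall>\<^sub>F t in nhds \<theta>. moment 1 t / moment 0 t = A' \<mu> t"
    using eventually_nhds_in_open[OF open_interior assms] by eventually_elim (simp add: A'_eq)
qed auto

lemma A''_eq:
  "\<theta> \<in> interior (natural_params \<mu>) \<Longrightarrow>
    A'' \<mu> \<theta> = moment 2 \<theta> / moment 0 \<theta> - (moment 1 \<theta> / moment 0 \<theta>)\<^sup>2"
  by (intro DERIV_imp_deriv A'_has_derivative_moment)

lemma DERIV_log_partition:
  "\<theta> \<in> interior (natural_params \<mu>) \<Longrightarrow> (log_partition \<mu> has_real_derivative A' \<mu> \<theta>) (at \<theta>)"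
  using log_partition_has_derivative A'_eq by simp

lemma DERIV_A':
  "\<theta> \<in> interior (natural_params \<mu>) \<Longrightarrow> (A' \<mu> has_real_derivative A'' \<mu> \<theta>) (at \<theta>)"
  using A'_has_derivative_moment A''_eq by simp

section \<open>The members of the family as probability measures: mean, variance, likelihood
  ratios\<close>

lemma sets_exp_family [measurable_cong, simp]: "sets (exp_family \<mu> t) = sets borel"
  by (simp add: exp_family_def sets_mu)

lemma space_exp_family [simp]: "space (exp_family \<mu> t) = UNIV"
  using sets_eq_imp_space_eq[OF sets_exp_family] by simp

lemma borel_measurable_exp_family [simp]:
  "borel_measurable (exp_family \<mu> t) = borel_measurable borel"
  using sets_exp_family by (rule measurable_cong_sets) simp

lemma prob_space_exp_family:
  assumes "t \<in> natural_params \<mu>"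
  shows "prob_space (exp_family \<mu> t)"
proof (rule prob_spaceI)
  have int: "integrable \<mu> (\<lambda>x. exp (t * x))" using assms natural_params_iff by simp
  define Z where "Z = (\<integral>x. exp (t * x) \<partial>\<mu>)"
  have Z: "Z > 0" using integral_exp_pos[OF assms] by (simp add: Z_def)
  have eq: "exp (t * x - log_partition \<mu> t) = exp (t * x) / Z" for x
    using Z by (simp add: exp_diff log_partition_def Z_def)
  have "emeasure (exp_family \<mu> t) (space (exp_family \<mu> t)) = (\<integral>\<^sup>+x. ennreal (exp (t * x) / Z) \<partial>\<mu>)"
    unfolding exp_family_def space_density
    by (subst emeasure_density) (auto simp: eq intro!: nn_integral_cong)
  also have "\<dots> = ennreal (\<integral>x. exp (t * x) / Z \<partial>\<mu>)"
    using Z int by (intro nn_integral_eq_integral) auto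
  also have "\<dots> = 1" using Z by (simp flip: Z_def)
  finally show "emeasure (exp_family \<mu> t) (space (exp_family \<mu> t)) = 1" .
qed

text \<open>The likelihood ratio of two members is itself exponential in \<open>x\<close>. Both its
  monotonicity and the computation of its second moment rest on this form.\<close>

lemma exp_family_change_param:
  "exp_family \<mu> t = density (exp_family \<mu> s)
     (\<lambda>x. ennreal (exp ((t - s) * x - (log_partition \<mu> t - log_partition \<mu> s))))"
  unfolding exp_family_def
  by (subst density_density_eq)
     (auto intro!: density_cong simp: algebra_simps simp flip: ennreal_mult exp_add)

lemma integrable_exp_family_iff:
  fixes f :: "real \<Rightarrow> real"
  assumes "f \<in> borel_measurable borel"
  shows "integrable (exp_family \<mu> t) f \<longleftrightarrow> integrable \<mu> (\<lambda>x. exp (t * x) * f x)"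
proof -
  have "integrable (exp_family \<mu> t) f \<longleftrightarrow>
      integrable \<mu> (\<lambda>x. exp (- log_partition \<mu> t) * (exp (t * x) * f x))"
    unfolding exp_family_def using assms
    by (subst integrable_real_density) (auto simp: exp_diff exp_minus field_simps)
  then show ?thesis by simp
qed

lemma integral_exp_family:
  fixes f :: "real \<Rightarrow> real"
  assumes "t \<in> natural_params \<mu>" "f \<in> borel_measurable borel"
  shows "(\<integral>x. f x \<partial>exp_family \<mu> t) = (\<integral>x. exp (t * x) * f x \<partial>\<mu>) / (\<integral>x. exp (t * x) \<partial>\<mu>)"
proof -
  have "(\<integral>x. f x \<partial>exp_family \<mu> t) = (\<integral>x. exp (t * x - log_partition \<mu> t) * f x \<partial>\<mu>)"
    unfolding exp_family_def using assms by (subst integral_real_density) auto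
  also have "\<dots> = (\<integral>x. exp (t * x) * f x / (\<integral>x. exp (t * x) \<partial>\<mu>) \<partial>\<mu>)"
    using integral_exp_pos[OF assms(1)] by (simp add: exp_diff log_partition_def)
  finally show ?thesis by simp
qed

lemma integrable_power_exp_family:
  assumes "\<theta> \<in> interior (natural_params \<mu>)"
  shows "integrable (exp_family \<mu> \<theta>) (\<lambda>x. (x - a) ^ k)"
proof -
  interpret prob_space "exp_family \<mu> \<theta>"
    using assms interior_subset by (intro prob_space_exp_family) blast
  have *: "integrable (exp_family \<mu> \<theta>) (\<lambda>x. x ^ j)" for j
    using integrable_moment[OF assms, of j] by (subst integrable_exp_family_iff) (auto simp: mult.commute)
  have "integrable (exp_family \<mu> \<theta>) (\<lambda>x. (\<Sum>j\<le>k. of_nat (k choose j) * x ^ j * (- a) ^ (k - j)))"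
    by (intro Bochner_Integration.integrable_sum integrable_mult_left integrable_mult_right *)
  then show ?thesis by (simp flip: binomial_ring)
qed

lemma expectation_exp_family:
  assumes "\<theta> \<in> interior (natural_params \<mu>)"
  shows "(\<integral>x. x \<partial>exp_family \<mu> \<theta>) = A' \<mu> \<theta>"
  using assms interior_subset
  by (subst integral_exp_family) (auto simp: A'_eq moment_def mult.commute)

lemma variance_exp_family:
  assumes "\<theta> \<in> interior (natural_params \<mu>)"
  shows "(\<integral>x. (x - A' \<mu> \<theta>)\<^sup>2 \<partial>exp_family \<mu> \<theta>) = A'' \<mu> \<theta>"
proof -
  let ?P = "exp_family \<mu> \<theta>"
  have \<theta>: "\<theta> \<in> natural_params \<mu>" using assms interior_subset by blast
  interpret prob_space ?P using \<theta> by (rule prob_space_exp_family)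
  have i1: "integrable ?P (\<lambda>x. x)" and i2: "integrable ?P (\<lambda>x. x\<^sup>2)"
    using integrable_power_exp_family[OF assms, of 0 1] integrable_power_exp_family[OF assms, of 0 2] by auto
  have "(\<integral>x. (x - A' \<mu> \<theta>)\<^sup>2 \<partial>?P) = (\<integral>x. x\<^sup>2 \<partial>?P) - (A' \<mu> \<theta>)\<^sup>2"
    using variance_eq[OF i1 i2] by (simp add: expectation_exp_family[OF assms])
  also have "(\<integral>x. x\<^sup>2 \<partial>?P) = moment 2 \<theta> / moment 0 \<theta>"
    by (subst integral_exp_family[OF \<theta>]) (auto simp: moment_def mult.commute)
  finally show ?thesis by (simp add: A''_eq[OF assms] A'_eq[OF assms])
qed

lemma A''_pos:
  assumes "\<theta> \<in> interior (natural_params \<mu>)"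
  shows "A'' \<mu> \<theta> > 0"
proof -
  let ?P = "exp_family \<mu> \<theta>"
  have "(\<integral>x. (x - A' \<mu> \<theta>)\<^sup>2 \<partial>?P) \<noteq> 0"
  proof
    assume "(\<integral>x. (x - A' \<mu> \<theta>)\<^sup>2 \<partial>?P) = 0"
    then have "AE x in ?P. (x - A' \<mu> \<theta>)\<^sup>2 = 0"
      using integrable_power_exp_family[OF assms] by (subst (asm) integral_nonneg_eq_0_iff_AE) auto
    \<comment> \<open>The density is strictly positive, so null sets of the member are null sets of
      \<open>\<mu>\<close>.\<close>
    then have "AE x in \<mu>. x = A' \<mu> \<theta>"
      unfolding exp_family_def by (subst (asm) AE_density) auto
    then show False using nondegenerate by blast
  qed
  moreover have "(\<integral>x. (x - A' \<mu> \<theta>)\<^sup>2 \<partial>?P) \<ge> 0" by simp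
  ultimately show ?thesis unfolding variance_exp_family[OF assms] by linarith
qed

text \<open>Squaring the ratio doubles the tilt: \<open>exp (\<theta> * x) * (L x)\<^sup>2\<close>
  is a constant times \<open>exp ((\<theta> + 2 * h) * x)\<close>. The value is one plus the
  chi-squared divergence of the member at \<open>\<theta> + h\<close> from that at
  \<open>\<theta>\<close>.\<close>

lemma likelihood_ratio_sq:
  assumes "\<theta> \<in> interior (natural_params \<mu>)" "\<theta> + 2 * h \<in> interior (natural_params \<mu>)"
  defines "L \<equiv> \<lambda>x. exp (h * x - (log_partition \<mu> (\<theta> + h) - log_partition \<mu> \<theta>))"
  shows "integrable (exp_family \<mu> \<theta>) (\<lambda>x. (L x)\<^sup>2)"
    and "(\<integral>x. (L x)\<^sup>2 \<partial>exp_family \<mu> \<theta>) =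
      exp (log_partition \<mu> (\<theta> + 2 * h) - 2 * log_partition \<mu> (\<theta> + h) + log_partition \<mu> \<theta>)"
proof -
  let ?A = "log_partition \<mu>"
  have \<theta>: "\<theta> \<in> natural_params \<mu>" "\<theta> + 2 * h \<in> natural_params \<mu>" using assms(1,2) interior_subset by blast+
  have [measurable]: "L \<in> borel_measurable borel" unfolding L_def by measurable
  have *: "exp (\<theta> * x) * (L x)\<^sup>2 = exp ((\<theta> + 2 * h) * x) * exp (2 * ?A \<theta> - 2 * ?A (\<theta> + h))" for x
    by (simp add: L_def algebra_simps flip: exp_add exp_of_nat_mult exp_double)
  show "integrable (exp_family \<mu> \<theta>) (\<lambda>x. (L x)\<^sup>2)"
    using \<theta>(2) by (subst integrable_exp_family_iff) (auto simp: * natural_params_iff)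
  have "(\<integral>x. (L x)\<^sup>2 \<partial>exp_family \<mu> \<theta>)
      = (\<integral>x. exp ((\<theta> + 2 * h) * x) \<partial>\<mu>) * exp (2 * ?A \<theta> - 2 * ?A (\<theta> + h)) / (\<integral>x. exp (\<theta> * x) \<partial>\<mu>)"
    by (subst integral_exp_family[OF \<theta>(1)]) (auto simp: *)
  also have "\<dots> = exp (?A (\<theta> + 2 * h)) * exp (2 * ?A \<theta> - 2 * ?A (\<theta> + h)) / exp (?A \<theta>)"
    using integral_exp_pos[OF \<theta>(1)] integral_exp_pos[OF \<theta>(2)] by (simp add: log_partition_def)
  also have "\<dots> = exp (?A (\<theta> + 2 * h) - 2 * ?A (\<theta> + h) + ?A \<theta>)"
    by (simp flip: exp_add exp_diff)
  finally show "(\<integral>x. (L x)\<^sup>2 \<partial>exp_family \<mu> \<theta>) =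
      exp (?A (\<theta> + 2 * h) - 2 * ?A (\<theta> + h) + ?A \<theta>)" .
qed

section \<open>Second-order estimates within the radius \<open>kappa\<close>\<close>

lemma kappa_bound:
  assumes "ereal r \<le> kappa \<mu> \<theta>" "\<bar>t - \<theta>\<bar> < r"
  shows "t \<in> interior (natural_params \<mu>)" "A'' \<mu> \<theta> / 2 \<le> A'' \<mu> t" "A'' \<mu> t \<le> 2 * A'' \<mu> \<theta>"
proof -
  \<comment> \<open>The supremum need not be attained; strictness yields an admissible radius
    \<open>q\<close> that still exceeds the distance to \<open>t\<close>.\<close>
  have "ereal \<bar>t - \<theta>\<bar> < kappa \<mu> \<theta>"
    using assms by (meson ereal_less(2) less_ereal.simps(1) order_less_le_trans)
  then obtain q where q: "\<bar>t - \<theta>\<bar> < q" "\<forall>s\<in>{\<theta> - q..\<theta> + q}. s \<in> interior (natural_params \<mu>) \<and>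
      A'' \<mu> \<theta> / A'' \<mu> s \<in> {1/2..2}"
    unfolding kappa_def less_Sup_iff by auto
  then have t: "t \<in> interior (natural_params \<mu>)" "A'' \<mu> \<theta> / A'' \<mu> t \<in> {1/2..2}"
    using bspec[OF q(2), of t] q(1) by (auto simp: abs_less_iff)
  then show "t \<in> interior (natural_params \<mu>)" by simp
  show "A'' \<mu> \<theta> / 2 \<le> A'' \<mu> t" "A'' \<mu> t \<le> 2 * A'' \<mu> \<theta>"
    using t(2) A''_pos[OF t(1)] by (auto simp: field_simps)
qed

text \<open>The mean value theorem for \<open>A'\<close>, with \<open>A''\<close> at least half its
  central value. The extra factor \<open>h\<close> lets one inequality serve both signs of
  \<open>h\<close>.\<close>

lemma A'_increment:
  assumes "ereal r \<le> kappa \<mu> \<theta>" "\<bar>h\<bar> < r"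
  shows "A'' \<mu> \<theta> * h\<^sup>2 / 2 \<le> h * (A' \<mu> (\<theta> + h) - A' \<mu> \<theta>)"
proof -
  have *: "\<exists>z. \<bar>z - \<theta>\<bar> \<le> \<bar>h\<bar> \<and> A' \<mu> (\<theta> + h) - A' \<mu> \<theta> = h * A'' \<mu> z"
  proof (cases h "0::real" rule: linorder_cases)
    case less
    have "\<exists>z>\<theta> + h. z < \<theta> \<and> A' \<mu> \<theta> - A' \<mu> (\<theta> + h) = (\<theta> - (\<theta> + h)) * A'' \<mu> z"
      using less assms by (intro MVT2 DERIV_A' kappa_bound(1)[OF assms(1)]) auto
    then obtain z where "z > \<theta> + h" "z < \<theta>" "A' \<mu> \<theta> - A' \<mu> (\<theta> + h) = - h * A'' \<mu> z" by auto
    then show ?thesis by (intro exI[of _ z]) (auto simp: algebra_simps)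
  next
    case greater
    have "\<exists>z>\<theta>. z < \<theta> + h \<and> A' \<mu> (\<theta> + h) - A' \<mu> \<theta> = (\<theta> + h - \<theta>) * A'' \<mu> z"
      using greater assms by (intro MVT2 DERIV_A' kappa_bound(1)[OF assms(1)]) auto
    then obtain z where "z > \<theta>" "z < \<theta> + h" "A' \<mu> (\<theta> + h) - A' \<mu> \<theta> = h * A'' \<mu> z" by auto
    then show ?thesis by (intro exI[of _ z]) auto
  qed auto
  then obtain z where z: "\<bar>z - \<theta>\<bar> \<le> \<bar>h\<bar>" "A' \<mu> (\<theta> + h) - A' \<mu> \<theta> = h * A'' \<mu> z" by blast
  have "h\<^sup>2 * (A'' \<mu> \<theta> / 2) \<le> h\<^sup>2 * A'' \<mu> z"
    using z(1) assms by (intro mult_left_mono kappa_bound(2)[OF assms(1)]) auto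
  then show ?thesis using z(2) by (simp add: power2_eq_square algebra_simps)
qed

text \<open>Two applications of the mean value theorem, to an increment of the log-partition
  function and then to \<open>A'\<close>, turn the second difference into \<open>h\<^sup>2\<close>
  times \<open>A''\<close> at an intermediate point, where \<open>A''\<close> is at most
  doubled.\<close>

lemma log_partition_second_difference:
  assumes "ereal r \<le> kappa \<mu> \<theta>" "2 * \<bar>h\<bar> < r"
  shows "log_partition \<mu> (\<theta> + 2 * h) - 2 * log_partition \<mu> (\<theta> + h) + log_partition \<mu> \<theta>
    \<le> 2 * A'' \<mu> \<theta> * h\<^sup>2"
proof -
  let ?A = "log_partition \<mu>"
  have int: "\<theta> + t \<in> interior (natural_params \<mu>)" if "\<bar>t\<bar> \<le> 2 * \<bar>h\<bar>" for t
    using that assms by (intro kappa_bound(1)[OF assms(1)]) auto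
  define a where "a = \<bar>h\<bar>"
  have a: "a \<ge> 0" "2 * a < r" using assms by (auto simp: a_def)
  show ?thesis
  proof (cases "h = 0")
    case False
    \<comment> \<open>The second difference is unchanged when its three nodes are reversed, so it
      may start at the left end \<open>s\<close> with the positive step \<open>a\<close>.\<close>
    define s where "s = (if h < 0 then \<theta> + 2 * h else \<theta>)"
    have s: "\<bar>s + u - \<theta>\<bar> \<le> 2 * \<bar>h\<bar>" if "0 \<le> u" "u \<le> 2 * a" for u
      using that by (auto simp: s_def a_def abs_if split: if_splits)
    have apos: "a > 0" using False by (simp add: a_def)
    have D: "(?A has_real_derivative A' \<mu> (s + u)) (at (s + u))"
      "(A' \<mu> has_real_derivative A'' \<mu> (s + u)) (at (s + u))" if "0 \<le> u" "u \<le> 2 * a" for u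
      using int[of "s + u - \<theta>"] s[OF that] by (auto intro!: DERIV_log_partition DERIV_A')
    have D1: "((\<lambda>u. ?A (s + a + u) - ?A (s + u)) has_real_derivative A' \<mu> (s + a + u) - A' \<mu> (s + u)) (at u)"
      if u: "0 \<le> u" "u \<le> a" for u
    proof -
      have "((\<lambda>u. ?A (s + a + u)) has_real_derivative A' \<mu> (s + a + u)) (at u)"
        using D(1)[of "a + u"] u a DERIV_shift[of ?A _ u "s + a"] by (simp add: ac_simps)
      moreover have "((\<lambda>u. ?A (s + u)) has_real_derivative A' \<mu> (s + u)) (at u)"
        using D(1)[of u] u a DERIV_shift[of ?A _ u s] by (simp add: ac_simps)
      ultimately show ?thesis by (rule DERIV_diff)
    qed
    obtain u where u: "0 < u" "u < a"
      "(?A (s + a + a) - ?A (s + a)) - (?A (s + a + 0) - ?A (s + 0)) = (a - 0) * (A' \<mu> (s + a + u) - A' \<mu> (s + u))"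
      using MVT2[OF apos, of "\<lambda>u. ?A (s + a + u) - ?A (s + u)" "\<lambda>u. A' \<mu> (s + a + u) - A' \<mu> (s + u)"] D1 by blast
    have "\<exists>z>s + u. z < s + a + u \<and> A' \<mu> (s + a + u) - A' \<mu> (s + u) = (s + a + u - (s + u)) * A'' \<mu> z"
    proof (rule MVT2)
      fix x assume "s + u \<le> x" "x \<le> s + a + u"
      then show "(A' \<mu> has_real_derivative A'' \<mu> x) (at x)"
        using D(2)[of "x - s"] u by auto
    qed (use apos in auto)
    then obtain z where z: "z > s + u" "z < s + a + u" "A' \<mu> (s + a + u) - A' \<mu> (s + u) = a * A'' \<mu> z"
      by auto
    have "A'' \<mu> z \<le> 2 * A'' \<mu> \<theta>"
      using s[of "z - s"] z u a by (intro kappa_bound(3)[OF assms(1)]) (auto simp: a_def)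
    then have "a\<^sup>2 * A'' \<mu> z \<le> a\<^sup>2 * (2 * A'' \<mu> \<theta>)" by (intro mult_left_mono) auto
    moreover have "?A (\<theta> + 2 * h) - 2 * ?A (\<theta> + h) + ?A \<theta> = ?A (s + a + a) - 2 * ?A (s + a) + ?A s"
      by (auto simp: s_def a_def abs_if algebra_simps)
    ultimately show ?thesis using u(3) z(3) by (simp add: a_def power2_eq_square algebra_simps)
  qed simp
qed

end

section \<open>Limits on testing\<close>

lemma tests_measurable: "T \<in> tests \<Longrightarrow> T m \<in> datasets m \<rightarrow>\<^sub>M prob_algebra (count_space UNIV)"
  by (auto simp: tests_def)

lemma private_tests_subset: "private_tests e \<subseteq> tests"
  by (auto simp: private_tests_def)

lemma sets_PiM_eq_datasets: "sets P = sets borel \<Longrightarrow> sets (PiM {..<m} (\<lambda>_. P)) = sets (datasets m)"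
  by (intro sets_PiM_cong) auto

context
  fixes T :: test and m :: nat and P :: "real measure"
  assumes T: "T \<in> tests" and P: "prob_space P" "sets P = sets borel"
begin

private lemma T_measurable: "T m \<in> PiM {..<m} (\<lambda>_. P) \<rightarrow>\<^sub>M prob_algebra (count_space UNIV)"
  using tests_measurable[OF T, of m] measurable_cong_sets[OF sets_PiM_eq_datasets[OF P(2)] refl] by blast

lemma measurable_output_measure [measurable]:
  "(\<lambda>x. measure (T m x) B) \<in> borel_measurable (PiM {..<m} (\<lambda>_. P))"
  using measurable_compose[OF T_measurable measurable_measure_prob_algebra] by simp

lemma prob_space_output: "x \<in> space (PiM {..<m} (\<lambda>_. P)) \<Longrightarrow> prob_space (T m x) \<and> sets (T m x) = UNIV"
  using measurable_space[OF T_measurable] by (auto simp: space_prob_algebra)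

lemma output_measure_complement:
  assumes "x \<in> space (PiM {..<m} (\<lambda>_. P))"
  shows "measure (T m x) {\<not> b} = 1 - measure (T m x) {b}"
proof -
  interpret prob_space "T m x" using prob_space_output[OF assms] by blast
  have "space (T m x) - {b} = {\<not> b}"
    using prob_space_output[OF assms] sets_eq_imp_space_eq[of "T m x" "count_space UNIV"] by auto
  then show ?thesis using prob_compl[of "{b}"] prob_space_output[OF assms] by simp
qed

lemma output_prob_eq: "output_prob T m P b = (\<integral>x. measure (T m x) {b} \<partial>PiM {..<m} (\<lambda>_. P))"
proof -
  interpret prob_space P by fact
  interpret PP: prob_space "PiM {..<m} (\<lambda>_. P)" by (intro prob_space_PiM P)
  show ?thesis unfolding output_prob_def
    by (rule PP.measure_bind[OF measurable_prob_algebraD[OF T_measurable]]) simp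
qed

lemma integrable_output_measure:
  "integrable (PiM {..<m} (\<lambda>_. P)) (\<lambda>x. measure (T m x) {b})"
proof -
  interpret PP: prob_space "PiM {..<m} (\<lambda>_. P)" by (intro prob_space_PiM P)
  show ?thesis
    using prob_space_output by (intro PP.integrable_const_bound[where B = 1] AE_I2)
      (auto intro!: prob_space.prob_le_1)
qed

lemma output_prob_complement: "output_prob T m P (\<not> b) = 1 - output_prob T m P b"
proof -
  interpret PP: prob_space "PiM {..<m} (\<lambda>_. P)" by (intro prob_space_PiM P)
  have "(\<integral>x. measure (T m x) {\<not> b} \<partial>PiM {..<m} (\<lambda>_. P)) = (\<integral>x. 1 - measure (T m x) {b} \<partial>PiM {..<m} (\<lambda>_. P))"
    by (intro Bochner_Integration.integral_cong output_measure_complement) auto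
  then show ?thesis using integrable_output_measure by (simp add: output_prob_eq PP.prob_space)
qed

end

section \<open>Product likelihood ratios and the second-moment obstruction to testing\<close>

lemma PiM_density:
  fixes f :: "'a \<Rightarrow> ennreal"
  assumes P: "prob_space P" and Q: "prob_space (density P f)" and f [measurable]: "f \<in> borel_measurable P"
    and I: "finite I"
  shows "PiM I (\<lambda>_. density P f) = density (PiM I (\<lambda>_. P)) (\<lambda>x. \<Prod>i\<in>I. f (x i))"
proof -
  interpret P: prob_space P by fact
  interpret Q: prob_space "density P f" by fact
  interpret PP: product_sigma_finite "\<lambda>_. P" by standard
  interpret QQ: product_sigma_finite "\<lambda>_. density P f" by standard
  have "density (PiM I (\<lambda>_. P)) (\<lambda>x. \<Prod>i\<in>I. f (x i)) = PiM I (\<lambda>_. density P f)"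
  \<comment> \<open>A finite product measure is determined by its values on rectangles; there the
    indicator splits into factors and the integral factorises.\<close>
  proof (rule QQ.PiM_eqI)
    show "sets (density (PiM I (\<lambda>_. P)) (\<lambda>x. \<Prod>i\<in>I. f (x i))) = sets (PiM I (\<lambda>_. density P f))"
      by (simp, intro sets_PiM_cong) auto
    fix A assume A: "\<And>i. i \<in> I \<Longrightarrow> A i \<in> sets (density P f)"
    then have [measurable]: "Pi\<^sub>E I A \<in> sets (PiM I (\<lambda>_. P))"
      using I by (intro sets_PiM_I_finite) auto
    have "emeasure (density (PiM I (\<lambda>_. P)) (\<lambda>x. \<Prod>i\<in>I. f (x i))) (Pi\<^sub>E I A)
        = (\<integral>\<^sup>+x. (\<Prod>i\<in>I. f (x i)) * indicator (Pi\<^sub>E I A) x \<partial>PiM I (\<lambda>_. P))"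
      using I by (subst emeasure_density) auto
    also have "\<dots> = (\<integral>\<^sup>+x. (\<Prod>i\<in>I. f (x i) * indicator (A i) (x i)) \<partial>PiM I (\<lambda>_. P))"
    proof (intro nn_integral_cong)
      fix x assume x: "x \<in> space (PiM I (\<lambda>_. P))"
      have "(indicator (Pi\<^sub>E I A) x :: ennreal) = (\<Prod>i\<in>I. indicator (A i) (x i))"
      proof (cases "x \<in> Pi\<^sub>E I A")
        case False
        then obtain i where "i \<in> I" "x i \<notin> A i" using x by (auto simp: space_PiM PiE_def Pi_def)
        then show ?thesis using False I by (simp add: prod_zero_iff) (auto simp: indicator_def)
      qed (auto simp: PiE_mem)
      then show "(\<Prod>i\<in>I. f (x i)) * indicator (Pi\<^sub>E I A) x = (\<Prod>i\<in>I. f (x i) * indicator (A i) (x i))"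
        by (simp add: prod.distrib)
    qed
    also have "\<dots> = (\<Prod>i\<in>I. \<integral>\<^sup>+x. f x * indicator (A i) x \<partial>P)"
      using A I by (subst PP.product_nn_integral_prod[where f = "\<lambda>i x. f x * indicator (A i) x"]) auto
    also have "\<dots> = (\<Prod>i\<in>I. emeasure (density P f) (A i))"
      using A by (intro prod.cong refl) (simp add: emeasure_density)
    finally show "emeasure (density (PiM I (\<lambda>_. P)) (\<lambda>x. \<Prod>i\<in>I. f (x i))) (Pi\<^sub>E I A)
        = (\<Prod>i\<in>I. emeasure (density P f) (A i))" .
  qed (fact I)
  then show ?thesis by simp
qed

text \<open>Completing the square and \<open>\<phi>\<^sup>2 \<le> \<phi>\<close> give
  \<open>\<Lambda> * \<phi> \<le> \<Lambda>\<^sup>2 / 4 + \<phi>\<close>. So acceptance under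
  \<open>Q\<close> exceeds acceptance under \<open>P\<close> by at most a quarter of the m-fold
  second moment, which is below \<open>1/2\<close>. A test correct on \<open>P\<close> accepts there
  with probability at most \<open>1/4\<close>, leaving less than \<open>3/4\<close> under
  \<open>Q\<close>.\<close>

lemma not_distinguishes_if_close:
  fixes L :: "real \<Rightarrow> real"
  assumes P: "prob_space P" "sets P = sets borel"
    and L [measurable]: "L \<in> borel_measurable borel" "\<And>x. L x \<ge> 0"
    and Q: "Q = density P (\<lambda>x. ennreal (L x))" "prob_space Q"
    and int: "integrable P (\<lambda>x. (L x)\<^sup>2)" and small: "(\<integral>x. (L x)\<^sup>2 \<partial>P) ^ m < 2"
    and T: "T \<in> tests"
  shows "\<not> distinguishes T m P Q"
proof
  assume D: "distinguishes T m P Q"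
  have mP [measurable]: "L \<in> borel_measurable P"
    using L(1) P(2) by (simp cong: measurable_cong_sets)
  have setsQ: "sets Q = sets borel" using P Q by simp
  interpret P: prob_space P by fact
  interpret PP: product_sigma_finite "\<lambda>_. P" by standard
  let ?PP = "PiM {..<m} (\<lambda>_. P)"
  interpret PPP: prob_space ?PP by (intro prob_space_PiM P)
  define \<phi> where "\<phi> x = measure (T m x) {True}" for x
  define \<Lambda> where "\<Lambda> x = (\<Prod>i<m. L (x i))" for x :: "nat \<Rightarrow> real"
  note [measurable] = measurable_output_measure[OF T P]
  have [measurable]: "\<phi> \<in> borel_measurable ?PP" "\<Lambda> \<in> borel_measurable ?PP"
    unfolding \<phi>_def \<Lambda>_def by measurable
  have \<phi>: "0 \<le> \<phi> x" "x \<in> space ?PP \<Longrightarrow> \<phi> x \<le> 1" for x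
    using prob_space_output[OF T P, of x m] by (auto simp: \<phi>_def intro!: prob_space.prob_le_1)
  have int_\<Lambda>: "integrable ?PP (\<lambda>x. (\<Lambda> x)\<^sup>2)"
    using PP.product_integrable_prod[of "{..<m}" "\<lambda>_ x. (L x)\<^sup>2"] int
    by (simp add: \<Lambda>_def prod_power_distrib)
  have "PiM {..<m} (\<lambda>_. Q) = density ?PP (\<lambda>x. ennreal (\<Lambda> x))"
    unfolding Q(1) \<Lambda>_def using Q L(2) by (subst PiM_density[OF P(1)]) (auto simp: prod_ennreal)
  then have "output_prob T m Q True = (\<integral>x. \<Lambda> x * \<phi> x \<partial>?PP)"
    using L(2) unfolding output_prob_eq[OF T Q(2) setsQ] \<phi>_def[symmetric]
    by (simp, subst integral_real_density) (auto simp: \<Lambda>_def prod_nonneg)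
  also have "\<dots> \<le> (\<integral>x. (\<Lambda> x)\<^sup>2 / 4 + \<phi> x \<partial>?PP)"
  \<comment> \<open>Only the majorant has to be integrable: a non-integrable left side would have
    Bochner integral 0, and the majorant is nonnegative.\<close>
  proof (rule integral_mono_AE')
    show "integrable ?PP (\<lambda>x. (\<Lambda> x)\<^sup>2 / 4 + \<phi> x)"
      using int_\<Lambda> integrable_output_measure[OF T P] by (simp add: \<phi>_def)
    show "AE x in ?PP. \<Lambda> x * \<phi> x \<le> (\<Lambda> x)\<^sup>2 / 4 + \<phi> x"
    proof (rule AE_I2)
      fix x assume "x \<in> space ?PP"
      have "\<phi> x * \<phi> x \<le> \<phi> x * 1" using \<phi> \<open>x \<in> space ?PP\<close> by (intro mult_left_mono)
      moreover have "0 \<le> (\<Lambda> x / 2 - \<phi> x)\<^sup>2" by simp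
      ultimately show "\<Lambda> x * \<phi> x \<le> (\<Lambda> x)\<^sup>2 / 4 + \<phi> x"
        by (simp add: power2_eq_square algebra_simps)
    qed
    show "AE x in ?PP. 0 \<le> (\<Lambda> x)\<^sup>2 / 4 + \<phi> x"
      using \<phi> by (intro AE_I2) auto
  qed
  also have "\<dots> = (\<integral>x. (L x)\<^sup>2 \<partial>P) ^ m / 4 + output_prob T m P True"
  proof -
    have "(\<integral>x. (\<Lambda> x)\<^sup>2 \<partial>?PP) = (\<integral>x. (L x)\<^sup>2 \<partial>P) ^ m"
      using PP.product_integral_prod[of "{..<m}" "\<lambda>_ x. (L x)\<^sup>2"] int
      by (simp add: \<Lambda>_def prod_power_distrib)
    then show ?thesis
      using int_\<Lambda> integrable_output_measure[OF T P] by (simp add: \<phi>_def output_prob_eq[OF T P])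
  qed
  also have "\<dots> < 1 / 2 + (1 - output_prob T m P False)"
    using small output_prob_complement[OF T P, of m False] by simp
  finally show False using D by (simp add: distinguishes_def)
qed

section \<open>Sample complexity and the modulus under a change of the class of tests\<close>

lemma sample_complexity_gt:
  assumes "\<And>T. T \<in> G \<Longrightarrow> \<not> distinguishes T n P Q"
  shows "sample_complexity G P Q > enat n"
proof (rule ccontr)
  assume "\<not> ?thesis"
  \<comment> \<open>The strict bound by \<open>Suc n\<close> extracts from the infimum an actual
    threshold \<open>j \<le> n\<close>, and its test would have to succeed at \<open>n\<close>
    itself.\<close>
  then have "sample_complexity G P Q < enat (Suc n)"
    by (metis enat_ord_simps(2) lessI not_less order_le_less_trans)
  then obtain j T where "j < Suc n" "T \<in> G" "\<forall>m\<ge>j. distinguishes T m P Q"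
    unfolding sample_complexity_def Inf_less_iff by auto
  with assms show False by (metis less_Suc_eq_le)
qed

lemma sample_complexity_le:
  assumes "T \<in> G" "\<And>m. m \<ge> n \<Longrightarrow> distinguishes T m P Q"
  shows "sample_complexity G P Q \<le> enat n"
  unfolding sample_complexity_def using assms by (intro Inf_lower) blast

lemma sample_complexity_antimono:
  "G \<subseteq> H \<Longrightarrow> sample_complexity H P Q \<le> sample_complexity G P Q"
  unfolding sample_complexity_def by (intro Inf_superset_mono) blast

text \<open>Fewer tests raise the sample complexity, so more parameters enter the supremum.\<close>

lemma modulus_mono:
  assumes "G \<subseteq> H"
  shows "modulus \<mu> n \<theta> H \<le> modulus \<mu> n \<theta> G"
  unfolding modulus_def
  using less_le_trans[OF _ sample_complexity_antimono[OF assms]] by (intro Sup_subset_mono) blast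

section \<open>Logistic tests\<close>

text \<open>The probabilities of both outcomes are sigmoids of the statistic, up to its sign, and the
  logarithm of the sigmoid is 1-Lipschitz; so a test is private as soon as its statistic has
  sensitivity \<open>\<epsilon>\<close>, without additional noise.\<close>

definition sigmoid :: "real \<Rightarrow> real" where
  "sigmoid u = 1 / (1 + exp (- u))"

definition logistic_test :: "(real \<Rightarrow> real) \<Rightarrow> test" where
  "logistic_test s m d = measure_pmf (bernoulli_pmf (sigmoid (\<Sum>i<m. s (d i))))"

lemma sigmoid_nonneg [simp]: "0 \<le> sigmoid u" and sigmoid_le_1 [simp]: "sigmoid u \<le> 1"
  by (auto simp: sigmoid_def add_pos_pos divide_simps add_nonneg_nonneg)

lemma one_minus_sigmoid: "1 - sigmoid u = sigmoid (- u)"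
proof -
  have "1 + exp u > 0" by (simp add: add_pos_pos)
  then show ?thesis by (simp add: sigmoid_def exp_minus field_simps)
qed

lemma sigmoid_le_exp: "sigmoid u \<le> exp u"
proof -
  have "1 + exp u \<ge> 1" by simp
  then show ?thesis by (simp add: sigmoid_def exp_minus divide_simps add_pos_pos)
qed

lemma sigmoid_ratio:
  assumes "u - v \<le> e" "e \<ge> 0"
  shows "sigmoid u \<le> exp e * sigmoid v"
proof -
  have "exp (- v) \<le> exp e * exp (- u)" using assms by (simp flip: exp_add)
  moreover have "1 \<le> exp e" using assms by simp
  ultimately have "1 + exp (- v) \<le> exp e * (1 + exp (- u))" unfolding distrib_left by linarith
  moreover have "1 + exp (- v) > 0" "1 + exp (- u) > 0" by (simp_all add: add_pos_pos)
  ultimately show ?thesis unfolding sigmoid_def by (simp add: divide_simps mult.commute)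
qed

lemma measure_logistic_test:
  "measure (logistic_test s m d) {b} = sigmoid (if b then \<Sum>i<m. s (d i) else - (\<Sum>i<m. s (d i)))"
  by (cases b) (simp_all add: logistic_test_def one_minus_sigmoid measure_pmf_single)

lemma logistic_test_in_tests:
  assumes [measurable]: "s \<in> borel_measurable borel"
  shows "logistic_test s \<in> tests"
proof -
  have "logistic_test s m \<in> datasets m \<rightarrow>\<^sub>M prob_algebra (count_space UNIV)" for m
  proof (intro measurable_prob_algebraI measurable_subprob_algebra)
    show "prob_space (logistic_test s m d)" for d
      by (simp add: logistic_test_def measure_pmf.prob_space_axioms)
    then show "subprob_space (logistic_test s m d)" for d
      by (rule prob_space_imp_subprob_space)
    show "sets (logistic_test s m d) = sets (count_space UNIV)" for d
      by (simp add: logistic_test_def)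
    fix A :: "bool set"
    have "emeasure (logistic_test s m d) A = ennreal (\<Sum>b\<in>A. measure (logistic_test s m d) {b})" for d
      unfolding logistic_test_def measure_pmf.emeasure_eq_measure
      by (subst measure_measure_pmf_finite) (auto simp: measure_pmf_single)
    moreover have "(\<lambda>d. \<Sum>b\<in>A. measure (logistic_test s m d) {b}) \<in> borel_measurable (datasets m)"
      unfolding measure_logistic_test sigmoid_def by measurable
    ultimately show "(\<lambda>d. emeasure (logistic_test s m d) A) \<in> borel_measurable (datasets m)"
      by simp
  qed
  then show ?thesis by (simp add: tests_def)
qed

lemma logistic_test_private:
  assumes s: "s \<in> borel_measurable borel" and "\<And>x y. s x - s y \<le> e" "e \<ge> 0"
  shows "logistic_test s \<in> private_tests e"
proof -
  have "measure (logistic_test s m d) E \<le> exp e * measure (logistic_test s m d') E"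
    if i: "i < m" "\<forall>j<m. j \<noteq> i \<longrightarrow> d j = d' j" for m d d' i E
  proof -
    \<comment> \<open>Isolating record \<open>i\<close> shows that the statistics differ by one
      summand; the bound over all pairs controls that difference in both directions.\<close>
    have sum: "(\<Sum>j<m. s (f j)) = s (f i) + (\<Sum>j\<in>{..<m}-{i}. s (f j))" for f
      using i by (subst sum.remove[of _ i]) auto
    have "(\<Sum>j\<in>{..<m}-{i}. s (d j)) = (\<Sum>j\<in>{..<m}-{i}. s (d' j))"
      using i by (intro sum.cong) auto
    then have "measure (logistic_test s m d) {b} \<le> exp e * measure (logistic_test s m d') {b}" for b
      unfolding measure_logistic_test using assms by (intro sigmoid_ratio) (auto simp: sum)
    \<comment> \<open>An event is a finite sum of outcomes, so the bound for single outcomes is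
      enough.\<close>
    then have "(\<Sum>b\<in>E. measure (logistic_test s m d) {b}) \<le> exp e * (\<Sum>b\<in>E. measure (logistic_test s m d') {b})"
      unfolding sum_distrib_left by (intro sum_mono)
    moreover have "measure (logistic_test s m f) E = (\<Sum>b\<in>E. measure (logistic_test s m f) {b})" for f
      unfolding logistic_test_def by (subst measure_measure_pmf_finite) (auto simp: measure_pmf_single)
    ultimately show ?thesis by simp
  qed
  then show ?thesis
    using logistic_test_in_tests[OF s] by (auto simp: private_tests_def differentially_private_def)
qed

text \<open>A Chernoff bound in which \<open>sigmoid u \<le> exp u\<close> plays the part of
  Markov's inequality: the exponential of the sum factorises over independent samples. The sign
  chosen by \<open>b\<close> covers both kinds of error.\<close>

lemma logistic_test_output_le:
  assumes P: "prob_space P" "sets P = sets borel" and s [measurable]: "s \<in> borel_measurable borel"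
    and int: "integrable P (\<lambda>x. exp (if b then s x else - s x))"
  shows "output_prob (logistic_test s) m P b \<le> (\<integral>x. exp (if b then s x else - s x) \<partial>P) ^ m"
proof -
  interpret P: prob_space P by fact
  interpret PP: product_sigma_finite "\<lambda>_. P" by standard
  let ?PP = "PiM {..<m} (\<lambda>_. P)"
  have "output_prob (logistic_test s) m P b = (\<integral>x. measure (logistic_test s m x) {b} \<partial>?PP)"
    by (rule output_prob_eq[OF logistic_test_in_tests[OF s] P])
  also have "\<dots> \<le> (\<integral>x. (\<Prod>i<m. exp (if b then s (x i) else - s (x i))) \<partial>?PP)"
  proof (rule integral_mono)
    show "integrable ?PP (\<lambda>x. measure (logistic_test s m x) {b})"
      by (rule integrable_output_measure[OF logistic_test_in_tests[OF s] P])
    show "integrable ?PP (\<lambda>x. \<Prod>i<m. exp (if b then s (x i) else - s (x i)))"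
      using int by (intro PP.product_integrable_prod) auto
    show "measure (logistic_test s m x) {b} \<le> (\<Prod>i<m. exp (if b then s (x i) else - s (x i)))" for x
      unfolding measure_logistic_test by (rule order_trans[OF sigmoid_le_exp]) (simp add: exp_sum flip: sum_negf)
  qed
  also have "\<dots> = (\<integral>x. exp (if b then s x else - s x) \<partial>P) ^ m"
    using int by (subst PP.product_integral_prod) auto
  finally show ?thesis .
qed

section \<open>Exponential moments of bounded scores and the resulting private test\<close>

lemma exp_le_quadratic:
  fixes y :: real
  assumes "\<bar>y\<bar> \<le> 1"
  shows "exp y \<le> 1 + y + y\<^sup>2"
proof (cases "y \<ge> 0")
  case True
  then show ?thesis using assms by (intro exp_bound) auto
next
  case False
  define z where "z = - y"
  have z: "0 < z" "z \<le> 1" using False assms by (auto simp: z_def)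
  have "1 + z + z\<^sup>2 / 2 \<le> exp z" using z by (intro exp_lower_Taylor_quadratic) auto
  \<comment> \<open>The claim at \<open>- z\<close> is a reciprocal form of the lower Taylor bound
    at \<open>z\<close>, so it suffices that the two quadratics have product at least 1.\<close>
  moreover have "1 \<le> (1 - z + z\<^sup>2) * (1 + z + z\<^sup>2 / 2)"
  proof -
    have "(1 - z + z\<^sup>2) * (1 + z + z\<^sup>2 / 2) = 1 + z\<^sup>2 / 2 + z ^ 3 / 2 + z ^ 4 / 2"
      by (simp add: field_simps power2_eq_square power3_eq_cube power4_eq_xxxx)
    then show ?thesis using z by simp
  qed
  moreover have "0 \<le> 1 - z + z\<^sup>2" using z by (simp add: add_nonneg_nonneg)
  ultimately have "1 \<le> (1 - z + z\<^sup>2) * exp z"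
    by (meson mult_left_mono order_trans)
  then have "exp (- z) \<le> 1 - z + z\<^sup>2" by (simp add: exp_minus field_simps)
  then show ?thesis by (simp add: z_def)
qed

text \<open>The quadratic term is at most \<open>c\<^sup>2\<close>; the last step
  \<open>1 + u \<le> exp u\<close> makes m-th powers of the bound exponentials again.\<close>

lemma (in prob_space) expectation_exp_le:
  fixes g :: "'a \<Rightarrow> real"
  assumes [measurable]: "g \<in> borel_measurable M" and g: "\<And>x. \<bar>g x\<bar> \<le> c" "c \<le> 1"
  shows "expectation (\<lambda>x. exp (g x)) \<le> exp (expectation g + c\<^sup>2)"
proof -
  have int: "integrable M g" using g by (intro integrable_const_bound[where B = c]) auto
  have "expectation (\<lambda>x. exp (g x)) \<le> expectation (\<lambda>x. 1 + g x + c\<^sup>2)"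
  proof (rule integral_mono)
    show "integrable M (\<lambda>x. exp (g x))"
      using g(1) by (intro integrable_const_bound[where B = "exp c"]) (auto simp: abs_le_iff)
    show "integrable M (\<lambda>x. 1 + g x + c\<^sup>2)" using int by simp
    show "exp (g x) \<le> 1 + g x + c\<^sup>2" for x
      using exp_le_quadratic[of "g x"] g(1)[of x] g(2) abs_le_square_iff[of "g x" c] by linarith
  qed
  also have "\<dots> = 1 + (expectation g + c\<^sup>2)" using int by (simp add: prob_space)
  also have "\<dots> \<le> exp (expectation g + c\<^sup>2)" by (rule exp_ge_add_one_self)
  finally show ?thesis .
qed

text \<open>With \<open>c = 1 / sqrt n\<close> the score \<open>c * (f - t)\<close> has mean at
  least \<open>3 / n\<close> away from 0 on the correct side. The quadratic term costs
  \<open>1 / n\<close>, leaving an exponent of at most \<open>- 2 / n\<close> per sample, so from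
  \<open>n\<close> samples on each error is at most \<open>exp (- 2) \<le> 1 / 4\<close>. Since
  \<open>f\<close> takes values in an interval of length 1, the sensitivity is at most
  \<open>c \<le> e\<close>.\<close>

lemma private_test_exists:
  fixes f :: "real \<Rightarrow> real" and n :: nat
  assumes P: "prob_space P" "sets P = sets borel" and Q: "prob_space Q" "sets Q = sets borel"
    and f [measurable]: "f \<in> borel_measurable borel" and f_le: "\<And>x. \<bar>f x\<bar> \<le> 1 / 2"
    and n: "n > 0" and e: "e \<ge> 1 / sqrt n"
    and gap: "6 / sqrt n \<le> (\<integral>x. f x \<partial>Q) - (\<integral>x. f x \<partial>P)"
  obtains T where "T \<in> private_tests e" "\<And>m. m \<ge> n \<Longrightarrow> distinguishes T m P Q"
proof -
  define c where "c = 1 / sqrt n"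
  have c: "0 < c" "c \<le> 1" "c\<^sup>2 = 1 / n" using n by (auto simp: c_def power_divide Suc_le_eq)
  \<comment> \<open>The midpoint splits the gap \<open>6 * c\<close> evenly and lies in the range
    bounds of \<open>f\<close>, so \<open>\<bar>f x - t\<bar> \<le> 1\<close>.\<close>
  define t where "t = ((\<integral>x. f x \<partial>Q) + (\<integral>x. f x \<partial>P)) / 2"
  define s where "s x = c * (f x - t)" for x
  have [measurable]: "s \<in> borel_measurable borel" unfolding s_def by measurable
  interpret P: prob_space P by fact
  interpret Q: prob_space Q by fact
  have [measurable]: "f \<in> borel_measurable P" "f \<in> borel_measurable Q" "s \<in> borel_measurable P" "s \<in> borel_measurable Q"
    using P(2) Q(2) by (simp_all cong: measurable_cong_sets)
  have intf: "integrable P f" "integrable Q f"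
    using f_le by (auto intro!: P.integrable_const_bound[where B = "1/2"] Q.integrable_const_bound[where B = "1/2"])
  have f_bounds: "- 1 / 2 \<le> f x" "f x \<le> 1 / 2" for x using f_le[of x] by linarith+
  have abs: "- 1 / 2 \<le> P.expectation f" "P.expectation f \<le> 1 / 2"
    "- 1 / 2 \<le> Q.expectation f" "Q.expectation f \<le> 1 / 2"
    by (intro P.integral_le_const Q.integral_le_const P.integral_ge_const Q.integral_ge_const
        AE_I2 intf f_bounds)+
  have s_le: "\<bar>s x\<bar> \<le> c" for x
  proof -
    have "\<bar>f x - t\<bar> \<le> 1" using f_bounds[of x] abs unfolding t_def abs_le_iff by (simp add: field_simps)
    then show ?thesis using c(1) by (simp add: s_def abs_mult)
  qed
  have E: "P.expectation s = c * (P.expectation f - t)" "Q.expectation s = c * (Q.expectation f - t)"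
    using intf unfolding s_def by (simp_all add: P.prob_space Q.prob_space)
  have gap': "6 * c \<le> Q.expectation f - P.expectation f" using gap by (simp add: c_def)
  have "c * (P.expectation f - t) \<le> c * (- 3 * c)" "c * (t - Q.expectation f) \<le> c * (- 3 * c)"
    using gap' c(1) unfolding t_def by (intro mult_left_mono; simp add: field_simps)+
  then have Es: "P.expectation s + c\<^sup>2 \<le> - 2 / n" "- Q.expectation s + c\<^sup>2 \<le> - 2 / n"
    using c(3) by (auto simp: E algebra_simps power2_eq_square)
  have exp2: "exp (- 2 :: real) \<le> 1 / 4"
  proof -
    have "2 * 2 \<le> exp (1::real) * exp 1" using exp_ge_add_one_self[of 1] by (intro mult_mono) auto
    then have "4 \<le> exp (2::real)" by (simp flip: exp_add)
    then show ?thesis by (simp add: exp_minus field_simps)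
  qed
  have power: "y ^ m \<le> 1 / 4" if "0 \<le> y" "y \<le> exp u" "u \<le> - 2 / n" "m \<ge> n" for y u :: real and m
  proof -
    have "y \<le> exp (- 2 / n)" using that(2,3) by (meson exp_le_cancel_iff order_trans)
    then have "y ^ m \<le> exp (- 2 / n) ^ m" using that by (intro power_mono)
    also have "\<dots> = exp (m * (- 2 / n))" by (simp flip: exp_of_nat_mult)
    also have "\<dots> \<le> exp (- 2)" using n \<open>m \<ge> n\<close> by (simp add: field_simps)
    finally show ?thesis using exp2 by simp
  qed
  have sm: "s \<in> borel_measurable borel" by measurable
  show ?thesis
  proof
    show "logistic_test s \<in> private_tests e"
    proof (rule logistic_test_private[OF sm])
      show "s x - s y \<le> e" for x y
      proof -
        have "s x - s y = c * (f x - f y)" by (simp add: s_def algebra_simps)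
        also have "\<dots> \<le> c * 1" using f_le[of x] f_le[of y] c by (intro mult_left_mono) auto
        finally show ?thesis using e by (simp add: c_def)
      qed
      show "0 \<le> e" using e by (rule order_trans[rotated]) simp
    qed
    fix m assume m: "m \<ge> n"
    have tst: "logistic_test s \<in> tests" by (rule logistic_test_in_tests[OF sm])
    have "output_prob (logistic_test s) m P True \<le> 1 / 4"
    proof -
      have "integrable P (\<lambda>x. exp (s x))"
        using s_le by (intro P.integrable_const_bound[where B = "exp c"]) (auto simp: abs_le_iff)
      then have "output_prob (logistic_test s) m P True \<le> P.expectation (\<lambda>x. exp (s x)) ^ m"
        using logistic_test_output_le[OF P sm, of True m] by simp
      also have "\<dots> \<le> 1 / 4"
        using s_le c Es by (intro power[OF _ P.expectation_exp_le _ m]) auto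
      finally show ?thesis .
    qed
    moreover have "output_prob (logistic_test s) m Q False \<le> 1 / 4"
    proof -
      have "integrable Q (\<lambda>x. exp (- s x))"
        using s_le by (intro Q.integrable_const_bound[where B = "exp c"]) (auto simp: abs_le_iff)
      then have "output_prob (logistic_test s) m Q False \<le> Q.expectation (\<lambda>x. exp (- s x)) ^ m"
        using logistic_test_output_le[OF Q sm, of False m] by simp
      also have "\<dots> \<le> 1 / 4"
        using s_le c Es by (intro power[OF _ Q.expectation_exp_le _ m]) auto
      finally show ?thesis .
    qed
    ultimately show "distinguishes (logistic_test s) m P Q"
      using output_prob_complement[OF tst P, of m True] output_prob_complement[OF tst Q, of m False]
      by (simp add: distinguishes_def)
  qed
qed

section \<open>The modulus of continuity\<close>

text \<open>Weighted AM-GM with weights \<open>G / F\<close> and \<open>F / G\<close>, so that upper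
  bounds on the two second moments can be inserted directly.\<close>

lemma (in prob_space) Cauchy_Schwarz_expectation:
  fixes f g :: "'a \<Rightarrow> real"
  assumes [measurable]: "f \<in> borel_measurable M" "g \<in> borel_measurable M"
    and int: "integrable M (\<lambda>x. (f x)\<^sup>2)" "integrable M (\<lambda>x. (g x)\<^sup>2)"
    and F: "expectation (\<lambda>x. (f x)\<^sup>2) \<le> F\<^sup>2" "F > 0"
    and G: "expectation (\<lambda>x. (g x)\<^sup>2) \<le> G\<^sup>2" "G > 0"
  shows "\<bar>expectation (\<lambda>x. f x * g x)\<bar> \<le> F * G"
proof -
  have *: "\<bar>f x * g x\<bar> \<le> (G / F) * (f x)\<^sup>2 / 2 + (F / G) * (g x)\<^sup>2 / 2" for x
  proof -
    have "0 \<le> (G * \<bar>f x\<bar> - F * \<bar>g x\<bar>)\<^sup>2 / (2 * F * G)"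
      using F G by simp
    also have "\<dots> = (G / F) * (f x)\<^sup>2 / 2 + (F / G) * (g x)\<^sup>2 / 2 - \<bar>f x * g x\<bar>"
      using F G by (simp add: power2_diff power_mult_distrib abs_mult field_simps power2_eq_square)
    finally show ?thesis by simp
  qed
  have i: "integrable M (\<lambda>x. (G / F) * (f x)\<^sup>2 / 2 + (F / G) * (g x)\<^sup>2 / 2)"
    using int by simp
  have ii: "integrable M (\<lambda>x. f x * g x)"
    by (rule Bochner_Integration.integrable_bound[OF i])
       (use * F G in \<open>auto intro!: AE_I2 order_trans[OF * abs_ge_self]\<close>)
  have "\<bar>expectation (\<lambda>x. f x * g x)\<bar> \<le> expectation (\<lambda>x. \<bar>f x * g x\<bar>)" by (rule integral_abs_bound)
  also have "\<dots> \<le> expectation (\<lambda>x. (G / F) * (f x)\<^sup>2 / 2 + (F / G) * (g x)\<^sup>2 / 2)"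
    using ii * i by (intro integral_mono) auto
  also have "\<dots> = (G / F) * expectation (\<lambda>x. (f x)\<^sup>2) / 2 + (F / G) * expectation (\<lambda>x. (g x)\<^sup>2) / 2"
    using int by simp
  also have "\<dots> \<le> (G / F) * F\<^sup>2 / 2 + (F / G) * G\<^sup>2 / 2"
    using F G by (intro add_mono divide_right_mono mult_left_mono) auto
  also have "\<dots> = F * G" using F G by (simp add: power2_eq_square)
  finally show "\<bar>expectation (\<lambda>x. f x * g x)\<bar> \<le> F * G" .
qed

context nondegenerate_measure
begin

text \<open>The likelihood ratio \<open>L\<close> is monotone and crosses 1 at \<open>a\<close>, and
  \<open>f - f a\<close> changes sign there in the same direction, so
  \<open>(f x - f a) * (L x - 1)\<close> is nonnegative. As \<open>L\<close> has mean 1, its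
  integral is the difference of the two means. The factor \<open>t - s\<close> in the monotonicity
  assumption orients \<open>f\<close> towards \<open>t\<close>.\<close>

lemma integral_exp_family_mono_param:
  fixes f :: "real \<Rightarrow> real"
  assumes s: "s \<in> natural_params \<mu>" and t: "t \<in> natural_params \<mu>"
    and f [measurable]: "f \<in> borel_measurable borel" and bounded: "\<And>x. \<bar>f x\<bar> \<le> B"
    and mono: "\<And>x y. x \<le> y \<Longrightarrow> (t - s) * f x \<le> (t - s) * f y"
  shows "(\<integral>x. f x \<partial>exp_family \<mu> s) \<le> (\<integral>x. f x \<partial>exp_family \<mu> t)"
proof (cases "t = s")
  case False
  let ?P = "exp_family \<mu> s" and ?Q = "exp_family \<mu> t"
  interpret P: prob_space ?P using s by (rule prob_space_exp_family)
  interpret Q: prob_space ?Q using t by (rule prob_space_exp_family)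
  \<comment> \<open>The slope of the chord of the log-partition function, which is where the
    exponent of \<open>L\<close> vanishes.\<close>
  define a where "a = (log_partition \<mu> t - log_partition \<mu> s) / (t - s)"
  define L where "L = (\<lambda>x. exp ((t - s) * x - (log_partition \<mu> t - log_partition \<mu> s)))"
  have L_eq: "L x = exp ((t - s) * (x - a))" for x
    proof -
    have "(t - s) * a = log_partition \<mu> t - log_partition \<mu> s" using False by (simp add: a_def)
    then show ?thesis by (simp add: L_def right_diff_distrib)
  qed
  have [measurable]: "L \<in> borel_measurable borel" unfolding L_def by measurable
  have Q: "?Q = density ?P (\<lambda>x. ennreal (L x))"
    unfolding L_def by (rule exp_family_change_param)
  have intP: "integrable ?P f" using bounded by (intro P.integrable_const_bound[where B = B]) auto
  have intQ: "integrable ?Q f" using bounded by (intro Q.integrable_const_bound[where B = B]) auto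
  have Lf: "integrable ?P (\<lambda>x. L x * f x)" "(\<integral>x. f x \<partial>?Q) = (\<integral>x. L x * f x \<partial>?P)"
    using intQ unfolding Q by (auto simp: integrable_real_density integral_real_density L_def)
  have L1: "integrable ?P L" "(\<integral>x. L x \<partial>?P) = 1"
    using Q.integrable_const[of "1::real"] Q.prob_space integral_real_density[of L ?P "\<lambda>_. 1"]
      integrable_real_density[of L ?P "\<lambda>_. 1"]
    unfolding Q by (auto simp: L_def)
  have "0 \<le> (f x - f a) * (L x - 1)" for x
  proof -
    consider "t > s" "x \<ge> a" | "t > s" "x \<le> a" | "t < s" "x \<ge> a" | "t < s" "x \<le> a"
      using False by linarith
    then show ?thesis
    proof cases
      case 1
      with mono[of a x] show ?thesis by (intro mult_nonneg_nonneg) (auto simp: L_eq)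
    next
      case 2
      with mono[of x a] show ?thesis by (intro mult_nonpos_nonpos) (auto simp: L_eq mult_nonneg_nonpos)
    next
      case 3
      with mono[of a x] show ?thesis by (intro mult_nonpos_nonpos) (auto simp: L_eq mult_nonpos_nonneg)
    next
      case 4
      with mono[of x a] show ?thesis by (intro mult_nonneg_nonneg) (auto simp: L_eq mult_nonpos_nonpos)
    qed
  qed
  then have "0 \<le> (\<integral>x. (f x - f a) * (L x - 1) \<partial>?P)" by simp
  also have "(\<integral>x. (f x - f a) * (L x - 1) \<partial>?P) = (\<integral>x. L x * f x - f x - (f a * L x - f a) \<partial>?P)"
    by (intro Bochner_Integration.integral_cong) (auto simp: algebra_simps)
  also have "\<dots> = (\<integral>x. f x \<partial>?Q) - (\<integral>x. f x \<partial>?P)"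
    using Lf L1 intP P.prob_space by simp
  finally show ?thesis by simp
qed simp

text \<open>Centred at the mean for \<open>\<theta>\<close> whatever parameter generates the data,
  and not rescaled: the threshold \<open>b\<close> carries the standard deviation.\<close>

definition clamp_score :: "real \<Rightarrow> real \<Rightarrow> real \<Rightarrow> real" where
  "clamp_score \<theta> b x = max (- b) (min b (x - A' \<mu> \<theta>))"

lemma borel_measurable_clamp_score [measurable]: "clamp_score \<theta> b \<in> borel_measurable borel"
  unfolding clamp_score_def by measurable

text \<open>Write \<open>V\<close> for \<open>A'' \<mu> \<theta>\<close>. The clamping error has L2
  norm at most \<open>sqrt V / 8\<close> and \<open>L - 1\<close> has norm at most
  \<open>2 * sqrt V * \<bar>h\<bar>\<close>. Their product \<open>V * \<bar>h\<bar> / 4\<close> is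
  half of the shift guaranteed for the unclamped mean, which accounts for the factor 8 in
  \<open>b\<close>.\<close>

lemma clamp_score_gap:
  assumes \<theta>: "\<theta> \<in> interior (natural_params \<mu>)"
    and fourth: "(\<integral>x. (x - A' \<mu> \<theta>) ^ 4 \<partial>exp_family \<mu> \<theta>) \<le> z * (A'' \<mu> \<theta>)\<^sup>2" and z: "z > 0"
    and kappa: "ereal r \<le> kappa \<mu> \<theta>" "2 * \<bar>h\<bar> < r"
    and small: "2 * A'' \<mu> \<theta> * h\<^sup>2 \<le> 1" and h: "h \<noteq> 0"
  defines "b \<equiv> 8 * sqrt z * sqrt (A'' \<mu> \<theta>)"
  shows "A'' \<mu> \<theta> * h\<^sup>2 / 4 \<le>
    h * ((\<integral>x. clamp_score \<theta> b x \<partial>exp_family \<mu> (\<theta> + h)) - (\<integral>x. clamp_score \<theta> b x \<partial>exp_family \<mu> \<theta>))"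
proof -
  let ?A = "log_partition \<mu>" and ?P = "exp_family \<mu> \<theta>" and ?Q = "exp_family \<mu> (\<theta> + h)"
  define V where "V = A'' \<mu> \<theta>"
  have V: "V > 0" using A''_pos[OF \<theta>] by (simp add: V_def)
  have b: "b > 0" using V z by (simp add: b_def V_def)
  define y where "y = (\<lambda>x. x - A' \<mu> \<theta>)"
  define \<rho> where "\<rho> = (\<lambda>x. y x - clamp_score \<theta> b x)"
  have [measurable]: "y \<in> borel_measurable borel" unfolding y_def by measurable
  have [measurable]: "\<rho> \<in> borel_measurable borel" unfolding \<rho>_def by measurable
  have \<theta>h: "\<theta> + h \<in> interior (natural_params \<mu>)" "\<theta> + 2 * h \<in> interior (natural_params \<mu>)"
    using kappa by (auto intro!: kappa_bound(1)[OF kappa(1)])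
  interpret P: prob_space ?P using \<theta> interior_subset by (intro prob_space_exp_family) blast
  interpret Q: prob_space ?Q using \<theta>h interior_subset by (intro prob_space_exp_family) blast
  define L where "L = (\<lambda>x. exp (h * x - (?A (\<theta> + h) - ?A \<theta>)))"
  have [measurable]: "L \<in> borel_measurable borel" unfolding L_def by measurable
  have Q: "?Q = density ?P (\<lambda>x. ennreal (L x))"
    using exp_family_change_param[of "\<theta> + h" \<theta>] by (simp add: L_def)
  have to_Q: "integrable ?Q g \<longleftrightarrow> integrable ?P (\<lambda>x. L x * g x)"
    "(\<integral>x. g x \<partial>?Q) = (\<integral>x. L x * g x \<partial>?P)" if [measurable]: "g \<in> borel_measurable borel" for g :: "real \<Rightarrow> real"
    unfolding Q by (simp_all add: integrable_real_density integral_real_density L_def)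
  have L1: "integrable ?P L" "P.expectation L = 1"
    using Q.integrable_const[of "1::real"] Q.prob_space to_Q[of "\<lambda>_. 1"] by auto
  have L2: "integrable ?P (\<lambda>x. (L x)\<^sup>2)"
    using likelihood_ratio_sq(1)[OF \<theta> \<theta>h(2)] by (simp add: L_def)

  \<comment> \<open>For \<open>0 \<le> u \<le> 1\<close> one has
    \<open>exp u - 1 \<le> u + u\<^sup>2 \<le> 2 * u\<close>; here
    \<open>u = 2 * V * h\<^sup>2\<close>.\<close>
  have chi: "P.expectation (\<lambda>x. (L x - 1)\<^sup>2) \<le> (2 * sqrt V * \<bar>h\<bar>)\<^sup>2"
  proof -
    let ?u = "2 * V * h\<^sup>2"
    have u: "0 \<le> ?u" "?u \<le> 1" using small V by (auto simp: V_def)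
    have "P.expectation (\<lambda>x. (L x - 1)\<^sup>2) = P.expectation (\<lambda>x. (L x)\<^sup>2) - 1"
      using L1 L2 P.prob_space by (simp add: power2_diff)
    also have "P.expectation (\<lambda>x. (L x)\<^sup>2) = exp (?A (\<theta> + 2 * h) - 2 * ?A (\<theta> + h) + ?A \<theta>)"
      using likelihood_ratio_sq(2)[OF \<theta> \<theta>h(2)] by (simp add: L_def)
    also have "\<dots> \<le> exp ?u"
      using log_partition_second_difference[OF kappa] by (simp add: V_def)
    also have "\<dots> \<le> 1 + ?u + ?u\<^sup>2" using u by (intro exp_bound) auto
    also have "?u\<^sup>2 \<le> ?u" using u mult_left_mono[of ?u 1 ?u] by (simp add: power2_eq_square)
    finally show ?thesis using V by (simp add: power_mult_distrib)
  qed

  \<comment> \<open>The error vanishes up to the threshold; beyond it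
    \<open>\<bar>y x\<bar> > b\<close>, so one factor of \<open>b\<close> is traded for one more
    power of \<open>y\<close>.\<close>
  have \<rho>_sq: "(\<rho> x)\<^sup>2 \<le> (y x) ^ 4 / b\<^sup>2" for x
  proof -
    have "\<bar>\<rho> x\<bar> \<le> (y x)\<^sup>2 / b"
    proof (cases "\<bar>y x\<bar> \<le> b")
      case True
      then have "\<rho> x = 0" by (auto simp: \<rho>_def clamp_score_def y_def)
      then show ?thesis using b by simp
    next
      case False
      then have "\<bar>\<rho> x\<bar> \<le> \<bar>y x\<bar>" using b by (auto simp: \<rho>_def clamp_score_def y_def)
      also have "\<bar>y x\<bar> * b \<le> \<bar>y x\<bar> * \<bar>y x\<bar>" using False by (intro mult_left_mono) auto
      then have "\<bar>y x\<bar> \<le> (y x)\<^sup>2 / b" using b by (simp add: field_simps power2_eq_square)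
      finally show ?thesis .
    qed
    then have "\<bar>\<rho> x\<bar>\<^sup>2 \<le> ((y x)\<^sup>2 / b)\<^sup>2" by (intro power_mono) auto
    then show ?thesis by (simp add: power_divide flip: power_mult)
  qed
  have y4: "integrable ?P (\<lambda>x. (y x) ^ 4 / b\<^sup>2)"
    using integrable_power_exp_family[OF \<theta>, of _ 4] by (simp add: y_def)
  have \<rho>2: "integrable ?P (\<lambda>x. (\<rho> x)\<^sup>2)"
    by (rule Bochner_Integration.integrable_bound[OF y4]) (use \<rho>_sq in auto)
  have \<rho>_bound: "P.expectation (\<lambda>x. (\<rho> x)\<^sup>2) \<le> (sqrt V / 8)\<^sup>2"
  proof -
    have "P.expectation (\<lambda>x. (\<rho> x)\<^sup>2) \<le> P.expectation (\<lambda>x. (y x) ^ 4 / b\<^sup>2)"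
      using \<rho>_sq y4 \<rho>2 by (intro integral_mono) auto
    also have "\<dots> \<le> z * V\<^sup>2 / b\<^sup>2"
      using fourth by (simp add: y_def V_def divide_right_mono)
    also have "\<dots> = (sqrt V / 8)\<^sup>2"
      using V z by (simp add: b_def power_mult_distrib power_divide flip: V_def) (simp add: power2_eq_square)
    finally show ?thesis .
  qed
  have "integrable ?P (\<lambda>x. (L x - 1)\<^sup>2)" using L1 L2 by (simp add: power2_diff)
  then have CS: "\<bar>P.expectation (\<lambda>x. \<rho> x * (L x - 1))\<bar> \<le> (sqrt V / 8) * (2 * sqrt V * \<bar>h\<bar>)"
    using \<rho>2 \<rho>_bound chi V h by (intro P.Cauchy_Schwarz_expectation) auto

  have yP: "integrable ?P y" "integrable ?Q y"
    using integrable_power_exp_family[OF \<theta>, of _ 1] integrable_power_exp_family[OF \<theta>h(1), of _ 1]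
    by (simp_all add: y_def)
  have yE: "Q.expectation y - P.expectation y = A' \<mu> (\<theta> + h) - A' \<mu> \<theta>"
    using integrable_power_exp_family[OF \<theta>, of 0 1] integrable_power_exp_family[OF \<theta>h(1), of 0 1]
      P.prob_space Q.prob_space
    by (simp add: y_def expectation_exp_family[OF \<theta>] expectation_exp_family[OF \<theta>h(1)])
  have cl: "integrable ?P (clamp_score \<theta> b)" "integrable ?Q (clamp_score \<theta> b)"
    using b by (auto intro!: P.integrable_const_bound[where B = b] Q.integrable_const_bound[where B = b]
        simp: clamp_score_def)
  \<comment> \<open>Moving to \<open>P\<close> turns the difference of two means into an inner
    product with \<open>L - 1\<close>, ready for Cauchy-Schwarz.\<close>
  have "Q.expectation \<rho> - P.expectation \<rho> = P.expectation (\<lambda>x. \<rho> x * (L x - 1))"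
  proof -
    have "integrable ?P \<rho>" "integrable ?Q \<rho>" unfolding \<rho>_def using yP cl by auto
    then have "integrable ?P \<rho>" "integrable ?P (\<lambda>x. L x * \<rho> x)" by (simp_all add: to_Q(1))
    then show ?thesis by (simp add: to_Q(2) algebra_simps)
  qed
  moreover have "Q.expectation \<rho> = Q.expectation y - Q.expectation (clamp_score \<theta> b)"
    "P.expectation \<rho> = P.expectation y - P.expectation (clamp_score \<theta> b)"
    unfolding \<rho>_def using yP cl by simp_all
  ultimately have eq: "Q.expectation (clamp_score \<theta> b) - P.expectation (clamp_score \<theta> b)
      = A' \<mu> (\<theta> + h) - A' \<mu> \<theta> - P.expectation (\<lambda>x. \<rho> x * (L x - 1))"
    using yE by linarith
  have "h * P.expectation (\<lambda>x. \<rho> x * (L x - 1)) \<le> \<bar>h\<bar> * \<bar>P.expectation (\<lambda>x. \<rho> x * (L x - 1))\<bar>"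
    by (metis abs_ge_self abs_mult)
  also have "\<dots> \<le> \<bar>h\<bar> * ((sqrt V / 8) * (2 * sqrt V * \<bar>h\<bar>))"
    using CS by (rule mult_left_mono) simp
  also have "\<dots> = V * h\<^sup>2 / 4" using V by (simp add: power2_eq_square)
  finally have "h * P.expectation (\<lambda>x. \<rho> x * (L x - 1)) \<le> V * h\<^sup>2 / 4" .
  moreover have "V * h\<^sup>2 / 2 \<le> h * (A' \<mu> (\<theta> + h) - A' \<mu> \<theta>)"
    using A'_increment[OF kappa(1), of h] kappa(2) by (simp add: V_def)
  ultimately show ?thesis unfolding eq V_def[symmetric] by (simp add: right_diff_distrib)
qed

section \<open>Lower and upper bounds for the modulus\<close>

lemma modulus_lower:
  assumes \<theta>: "\<theta> \<in> interior (natural_params \<mu>)" and n: "n > 0"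
    and kappa: "ereal r \<le> kappa \<mu> \<theta>" "1 / sqrt (n * A'' \<mu> \<theta>) < r"
  shows "ereal (1 / 2 / sqrt (n * A'' \<mu> \<theta>)) \<le> modulus \<mu> n \<theta> tests"
proof -
  let ?A = "log_partition \<mu>" and ?P = "exp_family \<mu> \<theta>"
  \<comment> \<open>This makes \<open>n * (2 * A'' \<mu> \<theta> * h\<^sup>2)\<close> equal to
    \<open>1 / 2\<close>, and \<open>exp (1 / 2) < 2\<close>. The tilt
    \<open>\<theta> + 2 * h\<close> of the squared ratio stays within the radius
    \<open>r\<close>.\<close>
  define h where "h = 1 / 2 / sqrt (n * A'' \<mu> \<theta>)"
  let ?Q = "exp_family \<mu> (\<theta> + h)"
  have V: "A'' \<mu> \<theta> > 0" using A''_pos[OF \<theta>] .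
  have h: "h > 0" "2 * \<bar>h\<bar> < r" "n * (2 * A'' \<mu> \<theta> * h\<^sup>2) = 1 / 2"
    using V n kappa(2) by (auto simp: h_def power_divide)
  have \<theta>h: "\<theta> + h \<in> interior (natural_params \<mu>)" "\<theta> + 2 * h \<in> interior (natural_params \<mu>)"
    using h by (auto intro!: kappa_bound(1)[OF kappa(1)])
  have np: "\<theta> \<in> natural_params \<mu>" "\<theta> + h \<in> natural_params \<mu>" using \<theta> \<theta>h interior_subset by blast+
  define L where "L = (\<lambda>x. exp (h * x - (?A (\<theta> + h) - ?A \<theta>)))"
  have "sample_complexity tests ?P ?Q > enat n"
  proof (rule sample_complexity_gt, rule not_distinguishes_if_close[where L = L])
    show "prob_space ?P" "prob_space ?Q" using np by (auto intro: prob_space_exp_family)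
    show "?Q = density ?P (\<lambda>x. ennreal (L x))"
      using exp_family_change_param[of "\<theta> + h" \<theta>] by (simp add: L_def)
    show "integrable ?P (\<lambda>x. (L x)\<^sup>2)" using likelihood_ratio_sq(1)[OF \<theta> \<theta>h(2)] by (simp add: L_def)
    have "(\<integral>x. (L x)\<^sup>2 \<partial>?P) = exp (?A (\<theta> + 2 * h) - 2 * ?A (\<theta> + h) + ?A \<theta>)"
      using likelihood_ratio_sq(2)[OF \<theta> \<theta>h(2)] by (simp add: L_def)
    also have "\<dots> \<le> exp (2 * A'' \<mu> \<theta> * h\<^sup>2)"
      using log_partition_second_difference[OF kappa(1) h(2)] by simp
    finally have "(\<integral>x. (L x)\<^sup>2 \<partial>?P) ^ n \<le> exp (2 * A'' \<mu> \<theta> * h\<^sup>2) ^ n"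
      by (rule power_mono) simp
    also have "\<dots> = exp (1 / 2)" using h(3) by (simp flip: exp_of_nat_mult)
    also have "\<dots> < (2 :: real)" using exp_bound[of "1/2"] by (simp add: power2_eq_square)
    finally show "(\<integral>x. (L x)\<^sup>2 \<partial>?P) ^ n < 2" .
    show "L \<in> borel_measurable borel" unfolding L_def by measurable
  qed (auto simp: L_def)
  then have "ereal h \<le> modulus \<mu> n \<theta> tests"
    unfolding modulus_def using np h(1) by (intro Sup_upper) (auto intro!: exI[of _ "\<theta> + h"])
  then show ?thesis unfolding h_def .
qed

text \<open>For \<open>t\<close> farther away than \<open>R\<close>, the gap is measured at a probe
  \<open>\<theta> + h\<close> near \<open>\<theta>\<close> and carried to \<open>t\<close> by
  monotonicity in the parameter, since \<open>t\<close> itself may lie where \<open>A''\<close> is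
  uncontrolled. The constant is \<open>1536 = 6 * 256\<close>: 6 is the gap a private test needs,
  and \<open>256 = 4 * 4 * 16\<close> collects \<open>R / 4\<close>, the quarter in
  \<open>clamp_score_gap\<close> and \<open>2 * b = 16 * sqrt z * sqrt V\<close>.\<close>

lemma modulus_upper:
  assumes \<theta>: "\<theta> \<in> interior (natural_params \<mu>)" and n: "n > 0"
    and fourth: "(\<integral>x. (x - A' \<mu> \<theta>) ^ 4 \<partial>exp_family \<mu> \<theta>) \<le> z * (A'' \<mu> \<theta>)\<^sup>2" and z: "z > 0"
    and C: "C \<ge> 1536 * sqrt z" "C > 0" "n \<ge> C\<^sup>2"
    and kappa: "ereal (C / sqrt (n * A'' \<mu> \<theta>)) \<le> kappa \<mu> \<theta>"
    and e: "e \<ge> 1 / sqrt n"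
  shows "modulus \<mu> n \<theta> (private_tests e) \<le> ereal (C / sqrt (n * A'' \<mu> \<theta>))"
  unfolding modulus_def
proof (rule Sup_least, clarify)
  fix t assume t: "t \<in> natural_params \<mu>"
    and SC: "sample_complexity (private_tests e) (exp_family \<mu> \<theta>) (exp_family \<mu> t) > enat n"
  let ?P = "exp_family \<mu> \<theta>"
  define V where "V = A'' \<mu> \<theta>"
  have V: "V > 0" using A''_pos[OF \<theta>] by (simp add: V_def)
  define R where "R = C / sqrt (n * V)"
  have R: "R > 0" using C V n by (simp add: R_def)
  show "ereal \<bar>\<theta> - t\<bar> \<le> ereal (C / sqrt (n * A'' \<mu> \<theta>))"
  proof (rule ccontr)
    assume "\<not> ?thesis"
    then have far: "\<bar>t - \<theta>\<bar> > R" by (simp add: R_def V_def abs_minus_commute)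
    define \<sigma> where "\<sigma> = sgn (t - \<theta>)"
    have \<sigma>: "\<sigma> = 1 \<and> t > \<theta> \<or> \<sigma> = - 1 \<and> t < \<theta>" using far R by (auto simp: \<sigma>_def sgn_if)
    \<comment> \<open>A quarter of \<open>R\<close> towards \<open>t\<close>: then
      \<open>2 * \<bar>h\<bar> < R\<close>, and \<open>n \<ge> C\<^sup>2\<close> gives
      \<open>V * h\<^sup>2 \<le> 1 / 16\<close>, as \<open>clamp_score_gap\<close> requires.\<close>
    define h where "h = \<sigma> * (R / 4)"
    have h: "\<bar>h\<bar> = R / 4" "h \<noteq> 0" "h = \<sigma> * \<bar>h\<bar>" "h\<^sup>2 = (R / 4)\<^sup>2" using \<sigma> R by (auto simp: h_def)
    have \<theta>h: "\<theta> + h \<in> natural_params \<mu>"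
      using kappa_bound(1)[OF kappa, of "\<theta> + h"] h R interior_subset by (auto simp: R_def V_def)
    have np: "\<theta> \<in> natural_params \<mu>" using \<theta> interior_subset by blast
    interpret P: prob_space ?P by (rule prob_space_exp_family[OF np])
    define b where "b = 8 * sqrt z * sqrt V"
    have b: "b > 0" using z V by (simp add: b_def)
    \<comment> \<open>The sign makes the mean of \<open>f\<close> grow towards \<open>t\<close>;
      dividing by \<open>2 * b\<close> fits the range into \<open>[-1/2, 1/2]\<close>.\<close>
    define f where "f = (\<lambda>x. \<sigma> * clamp_score \<theta> b x / (2 * b))"
    have f_meas [measurable]: "f \<in> borel_measurable borel" unfolding f_def by measurable
    have f_le: "\<bar>f x\<bar> \<le> 1 / 2" for x
      using b \<sigma> by (auto simp: f_def clamp_score_def abs_mult abs_le_iff divide_simps)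
    have h2: "V * h\<^sup>2 = C\<^sup>2 / (16 * n)"
      using V n by (simp add: h(4) R_def power_divide)
    have "\<bar>h\<bar> * (V * \<bar>h\<bar> / 4) = V * h\<^sup>2 / 4"
      using abs_mult_self_eq[of h]
      by (simp only: power2_eq_square mult_ac times_divide_eq_right times_divide_eq_left)
    also have "\<dots> \<le> h * ((\<integral>x. clamp_score \<theta> b x \<partial>exp_family \<mu> (\<theta> + h)) - (\<integral>x. clamp_score \<theta> b x \<partial>?P))"
      unfolding V_def b_def
    proof (rule clamp_score_gap[OF \<theta> fourth z kappa])
      show "2 * \<bar>h\<bar> < C / sqrt (n * A'' \<mu> \<theta>)" using h(1) R by (simp add: R_def V_def)
      have "V * h\<^sup>2 \<le> 1 / 16" unfolding h2 using C(3) n by (simp add: field_simps)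
      then show "2 * A'' \<mu> \<theta> * h\<^sup>2 \<le> 1" by (simp add: V_def)
    qed (fact h)
    also have "\<dots> = \<bar>h\<bar> * (2 * b) * ((\<integral>x. f x \<partial>exp_family \<mu> (\<theta> + h)) - (\<integral>x. f x \<partial>?P))"
      using b by (subst h(3)) (simp add: f_def field_simps)
    finally have "\<bar>h\<bar> * (V * \<bar>h\<bar> / 4) \<le> \<bar>h\<bar> * ((2 * b) * ((\<integral>x. f x \<partial>exp_family \<mu> (\<theta> + h)) - (\<integral>x. f x \<partial>?P)))"
      by (simp only: mult.assoc)
    then have gap1: "V * \<bar>h\<bar> / 4 \<le> (2 * b) * ((\<integral>x. f x \<partial>exp_family \<mu> (\<theta> + h)) - (\<integral>x. f x \<partial>?P))"
      using h(2) by simp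
    have "6 / sqrt n \<le> V * \<bar>h\<bar> / 4 / (2 * b)"
    proof -
      have "V * \<bar>h\<bar> = sqrt V * C / (4 * sqrt n)"
        using V n unfolding h(1) R_def by (simp add: real_sqrt_mult field_simps)
      then have "V * \<bar>h\<bar> / 4 / (2 * b) = C / (256 * sqrt z) / sqrt n"
        using V z by (simp add: b_def)
      moreover have "6 \<le> C / (256 * sqrt z)" using C(1) z by (simp add: field_simps)
      ultimately show ?thesis using divide_right_mono[of 6 "C / (256 * sqrt z)" "sqrt n"] by simp
    qed
    also have "\<dots> \<le> (\<integral>x. f x \<partial>exp_family \<mu> (\<theta> + h)) - (\<integral>x. f x \<partial>?P)"
      using gap1 b by (simp add: field_simps)
    also have "\<dots> \<le> (\<integral>x. f x \<partial>exp_family \<mu> t) - (\<integral>x. f x \<partial>?P)"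
    proof -
      \<comment> \<open>The probe lies between \<open>\<theta>\<close> and \<open>t\<close>, so
        moving on from it to \<open>t\<close> keeps the direction \<open>\<sigma>\<close>.\<close>
      have pos: "0 \<le> \<sigma> * (t - (\<theta> + h))" using \<sigma> far R by (auto simp: h_def)
      have "(t - (\<theta> + h)) * f u \<le> (t - (\<theta> + h)) * f v" if "u \<le> v" for u v
      proof -
        have "clamp_score \<theta> b u \<le> clamp_score \<theta> b v" using that by (auto simp: clamp_score_def)
        then have "(\<sigma> * (t - (\<theta> + h)) / (2 * b)) * clamp_score \<theta> b u
            \<le> (\<sigma> * (t - (\<theta> + h)) / (2 * b)) * clamp_score \<theta> b v"
          using pos b by (intro mult_left_mono) auto
        then show ?thesis by (simp add: f_def mult_ac)
      qed
      then show ?thesis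
        using integral_exp_family_mono_param[OF \<theta>h t f_meas f_le] by simp
    qed
    finally have gap: "6 / sqrt n \<le> (\<integral>x. f x \<partial>exp_family \<mu> t) - (\<integral>x. f x \<partial>?P)" .
    obtain T where "T \<in> private_tests e" "\<And>m. m \<ge> n \<Longrightarrow> distinguishes T m ?P (exp_family \<mu> t)"
      using private_test_exists[OF prob_space_exp_family[OF np] sets_exp_family
          prob_space_exp_family[OF t] sets_exp_family f_meas f_le n e gap] by blast
    then show False using sample_complexity_le SC by (meson not_le)
  qed
qed

end

section \<open>Choice of constants and comparison with unrestricted tests\<close>

theorem proposition4p13:
  fixes \<zeta> :: real
  assumes "\<zeta> > 0"
  shows "\<exists>(k::real) (C1::real) (C2::real) (N::nat) (c1::real) (c2::real).
    k > 0 \<and> C1 > 0 \<and> C2 > 0 \<and> N > 0 \<and> c1 > 0 \<and> c2 > 0 \<and>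
    (\<forall>(\<mu>::real measure) (\<theta>::real) (\<epsilon>::nat \<Rightarrow> real) (n::nat).
      sets \<mu> = sets borel \<longrightarrow>
      \<not> (\<exists>x. AE y in \<mu>. y = x) \<longrightarrow>
      \<theta> \<in> interior (natural_params \<mu>) \<longrightarrow>
      (\<forall>m. \<epsilon> m > 0) \<longrightarrow>
      n \<ge> N \<longrightarrow>
      \<epsilon> n \<ge> k / sqrt (real n) \<longrightarrow>
      (\<forall>\<theta>'\<in>kappa_interval \<mu> \<theta>.
         (\<integral>x. (x - A' \<mu> \<theta>') ^ 4 \<partial>(exp_family \<mu> \<theta>')) / (A'' \<mu> \<theta>')\<^sup>2 \<le> \<zeta>) \<longrightarrow>
      kappa \<mu> \<theta> \<ge> ereal (C2 / sqrt (real n * A'' \<mu> \<theta>)) \<longrightarrow>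
      (ereal (C1 / sqrt (real n * A'' \<mu> \<theta>)) \<le> modulus \<mu> n \<theta> (private_tests (\<epsilon> n)) \<and>
       modulus \<mu> n \<theta> (private_tests (\<epsilon> n)) \<le> ereal (C2 / sqrt (real n * A'' \<mu> \<theta>))) \<and>
      (ereal c1 * modulus \<mu> n \<theta> tests \<le> modulus \<mu> n \<theta> (private_tests (\<epsilon> n)) \<and>
       modulus \<mu> n \<theta> (private_tests (\<epsilon> n)) \<le> ereal c2 * modulus \<mu> n \<theta> tests))"
proof -
  \<comment> \<open>The first summand serves the upper bound; the second forces
    \<open>C > 1\<close>, so that the radius strictly exceeds
    \<open>1 / sqrt (n * A'' \<mu> \<theta>)\<close> as the lower bound demands. The choice of
    \<open>N\<close> gives \<open>n \<ge> C\<^sup>2\<close>.\<close>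
  define C where "C = 1536 * sqrt \<zeta> + 2"
  define N where "N = nat \<lceil>C\<^sup>2\<rceil> + 1"
  have C: "C \<ge> 1536 * sqrt \<zeta>" "C > 1" using assms by (auto simp: C_def add_pos_pos intro: add_nonneg_pos)
  show ?thesis
  proof (rule exI[of _ 1], rule exI[of _ "1 / 2"], rule exI[of _ C], rule exI[of _ N],
      rule exI[of _ 1], rule exI[of _ "2 * C"], intro conjI allI impI)
    fix \<mu> :: "real measure" and \<theta> :: real and \<epsilon> :: "nat \<Rightarrow> real" and n :: nat
    assume "sets \<mu> = sets borel" "\<not> (\<exists>x. AE y in \<mu>. y = x)"
    then interpret nondegenerate_measure \<mu> by unfold_locales
    assume \<theta>: "\<theta> \<in> interior (natural_params \<mu>)" and n: "n \<ge> N" and e: "\<epsilon> n \<ge> 1 / sqrt n"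
      and fourth: "\<forall>\<theta>'\<in>kappa_interval \<mu> \<theta>.
         (\<integral>x. (x - A' \<mu> \<theta>') ^ 4 \<partial>(exp_family \<mu> \<theta>')) / (A'' \<mu> \<theta>')\<^sup>2 \<le> \<zeta>"
      and kappa: "kappa \<mu> \<theta> \<ge> ereal (C / sqrt (real n * A'' \<mu> \<theta>))"
    let ?r = "sqrt (real n * A'' \<mu> \<theta>)"
    have n0: "n > 0" "n \<ge> C\<^sup>2" using n unfolding N_def by linarith+
    have V: "A'' \<mu> \<theta> > 0" by (rule A''_pos[OF \<theta>])
    have r: "?r > 0" using V n0 by simp
    have "0 \<le> kappa \<mu> \<theta>" using r C by (intro order_trans[OF _ kappa]) simp
    then have "\<theta> \<in> kappa_interval \<mu> \<theta>" using \<theta> by (simp add: kappa_interval_def flip: zero_ereal_def)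
    then have z: "(\<integral>x. (x - A' \<mu> \<theta>) ^ 4 \<partial>exp_family \<mu> \<theta>) \<le> \<zeta> * (A'' \<mu> \<theta>)\<^sup>2"
      using fourth V by (auto simp: field_simps)
    have lower: "ereal (1 / 2 / ?r) \<le> modulus \<mu> n \<theta> tests"
      using C r by (intro modulus_lower[OF \<theta> n0(1) kappa] divide_strict_right_mono)
    have mono: "modulus \<mu> n \<theta> tests \<le> modulus \<mu> n \<theta> (private_tests (\<epsilon> n))"
      by (intro modulus_mono private_tests_subset)
    show "ereal (1 / 2 / ?r) \<le> modulus \<mu> n \<theta> (private_tests (\<epsilon> n))"
      using lower mono by (rule order_trans)
    show upper: "modulus \<mu> n \<theta> (private_tests (\<epsilon> n)) \<le> ereal (C / ?r)"
      using C by (intro modulus_upper[OF \<theta> n0(1) z assms] kappa e n0) auto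
    show "ereal 1 * modulus \<mu> n \<theta> tests \<le> modulus \<mu> n \<theta> (private_tests (\<epsilon> n))"
      using mono by (simp flip: one_ereal_def)
    \<comment> \<open>The lower bound holds already for the class of all tests, so the private upper
      bound exceeds the unrestricted modulus by at most the ratio \<open>C / (1 / 2)\<close> of the
      constants.\<close>
    have "ereal (C / ?r) = ereal (2 * C) * ereal (1 / 2 / ?r)" by simp
    also have "\<dots> \<le> ereal (2 * C) * modulus \<mu> n \<theta> tests"
      using C by (intro ereal_mult_left_mono lower) simp
    finally show "modulus \<mu> n \<theta> (private_tests (\<epsilon> n)) \<le> ereal (2 * C) * modulus \<mu> n \<theta> tests"
      using upper by (rule order_trans[rotated])
  qed (use C in \<open>auto simp: N_def\<close>)
qed

end
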